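(* Let $G=(V,E)$ be a finite tree with positive real edge lengths $\{\alpha_e : e\in E\}$, and let $D$ be the corresponding distance matrix, whose $(u,v)$-entry is the sum of $\alpha_e$ over the edges $e$ on the unique path from $u$ to $v$. For any nonempty subset $S\subseteq V$, with $D[S]$ the principal submatrix indexed by $S$, \[ \det D[S] = (-1)^{|S|-1} 2^{|S|-2}\Bigg( \sum_{e\in E}\alpha_e \sum_{T\in\mathcal{F}_1(G;S)} w(T) \;-\; \sum_{F\in\mathcal{F}_2(G;S)} w(F)\,\big(\operatorname{outdeg}(F,* )-2\big)^2\Bigg). \]
   Context: A spanning forest of $G$ is an acyclic subgraph containing all vertices of $G$. $\mathcal{F}_1(G;S)$ is the set of $S$-rooted spanning forests: spanning forests each of whose connected components contains exactly one vertex of $S$. $\mathcal{F}_2(G;S)$ is the set of $(S,* )$-rooted spanning forests: spanning forests with $|S|+1$ components, $|S|$ of which each contain exactly one vertex of $S$, and one further component (the floating component $F( * )$) containing no vertex of $S$. $\operatorname{outdeg}(F,* )$ is the number of edges of $G$ with exactly one endpoint in the vertex set of $F( * )$. For a subgraph $H$ with edge set $A\subseteq E$, its weight is $w(H)=\prod_{e\in E\setminus A}\alpha_e$. *)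

theory Defs
  imports "Jordan_Normal_Form.Determinant"
begin

text \<open>
  Undirected simple graphs are given by a vertex set \<open>V\<close> and a set \<open>E\<close> of two-element
  subsets of \<open>V\<close>. A spanning subgraph has the same vertex set \<open>V\<close>, so it is
  represented by its edge set \<open>A \<subseteq> E\<close>.
\<close>

definition finite_graph :: "'a set \<Rightarrow> 'a set set \<Rightarrow> bool" where
  "finite_graph V E \<longleftrightarrow> finite V \<and> (\<forall>e\<in>E. e \<subseteq> V \<and> card e = 2)"

definition is_path :: "'a set set \<Rightarrow> 'a \<Rightarrow> 'a \<Rightarrow> 'a list \<Rightarrow> bool" where
  "is_path E u v p \<longleftrightarrow>
     p \<noteq> [] \<and> hd p = u \<and> last p = v \<and> distinct p \<and> successively (\<lambda>x y. {x, y} \<in> E) p"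

definition path_edges :: "'a list \<Rightarrow> 'a set set" where
  "path_edges p = {{p ! i, p ! Suc i} | i. Suc i < length p}"

definition is_cycle :: "'a set set \<Rightarrow> 'a list \<Rightarrow> bool" where
  "is_cycle E c \<longleftrightarrow>
     length c \<ge> 3 \<and> distinct c \<and> successively (\<lambda>x y. {x, y} \<in> E) c \<and> {last c, hd c} \<in> E"

definition acyclic_graph :: "'a set set \<Rightarrow> bool" where
  "acyclic_graph E \<longleftrightarrow> (\<nexists>c. is_cycle E c)"

definition connected_graph :: "'a set \<Rightarrow> 'a set set \<Rightarrow> bool" where
  "connected_graph V E \<longleftrightarrow> V \<noteq> {} \<and> (\<forall>u\<in>V. \<forall>v\<in>V. \<exists>p. is_path E u v p)"

definition finite_tree :: "'a set \<Rightarrow> 'a set set \<Rightarrow> bool" where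
  "finite_tree V E \<longleftrightarrow> finite_graph V E \<and> connected_graph V E \<and> acyclic_graph E"

text \<open>Connected components are identified with their vertex sets.\<close>

definition graph_components :: "'a set \<Rightarrow> 'a set set \<Rightarrow> 'a set set" where
  "graph_components V A = (\<lambda>u. {v \<in> V. \<exists>p. is_path A u v p}) ` V"

definition spanning_forests :: "'a set set \<Rightarrow> 'a set set set" where
  "spanning_forests E = {A. A \<subseteq> E \<and> acyclic_graph A}"

definition rooted_forests :: "'a set \<Rightarrow> 'a set set \<Rightarrow> 'a set \<Rightarrow> 'a set set set" where
  "rooted_forests V E S =
     {A \<in> spanning_forests E. \<forall>C\<in>graph_components V A. \<exists>!s. s \<in> C \<inter> S}"

definition floating_rooted_forests :: "'a set \<Rightarrow> 'a set set \<Rightarrow> 'a set \<Rightarrow> 'a set set set" where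
  "floating_rooted_forests V E S =
     {A \<in> spanning_forests E.
        card (graph_components V A) = card S + 1 \<and>
        card {C \<in> graph_components V A. \<exists>!s. s \<in> C \<inter> S} = card S \<and>
        (\<exists>C\<in>graph_components V A. C \<inter> S = {})}"

definition floating_component :: "'a set \<Rightarrow> 'a set \<Rightarrow> 'a set set \<Rightarrow> 'a set" where
  "floating_component V S A = (THE C. C \<in> graph_components V A \<and> C \<inter> S = {})"

definition floating_outdeg :: "'a set \<Rightarrow> 'a set set \<Rightarrow> 'a set \<Rightarrow> 'a set set \<Rightarrow> nat" where
  "floating_outdeg V E S A = card {e \<in> E. card (e \<inter> floating_component V S A) = 1}"

text \<open>The weight multiplies the lengths of the edges \<^emph>\<open>not\<close> in the subgraph.\<close>

definition coweight :: "'a set set \<Rightarrow> ('a set \<Rightarrow> real) \<Rightarrow> 'a set set \<Rightarrow> real" where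
  "coweight E \<alpha> A = (\<Prod>e\<in>E - A. \<alpha> e)"

definition tree_dist :: "'a set set \<Rightarrow> ('a set \<Rightarrow> real) \<Rightarrow> 'a \<Rightarrow> 'a \<Rightarrow> real" where
  "tree_dist E \<alpha> u v = (\<Sum>e\<in>path_edges (THE p. is_path E u v p). \<alpha> e)"

text \<open>
  A matrix with rows and columns indexed by vertices is a function \<open>D\<close>. Its principal
  submatrix on the set enumerated by a distinct list \<open>ss\<close> is written down in the order
  of \<open>ss\<close>.
\<close>

definition principal_submatrix :: "('a \<Rightarrow> 'a \<Rightarrow> real) \<Rightarrow> 'a list \<Rightarrow> real mat" where
  "principal_submatrix D ss =
     mat (length ss) (length ss) (\<lambda>(i, j). D (ss ! i) (ss ! j))"

end

theory Submission
  imports Defs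
begin

text \<open>
  Let \<open>B(w, u)\<close> be the determinant of the distance table with rows \<open>w, S\<close> and columns \<open>u, S\<close>,
  bordered by a row and a column of ones. Removing the leaves of the tree one at a time shows that
  \<open>B(w, u) = - (-2)^|S| Z(w, u)\<close>, where \<open>Z(w, u)\<close> sums the weights of the \<open>(S, *)\<close>-rooted forests
  whose floating component contains both \<open>u\<close> and \<open>w\<close>; for \<open>u = w\<close> this also counts the forests
  rooted at \<open>S \<union> {u}\<close>. Now weight each vertex \<open>x\<close> by \<open>2 - deg x\<close>. The weights of a connected set
  of vertices sum to \<open>2\<close> minus its outdegree, so summing \<open>Z\<close> against them in both arguments
  gives the squares in the formula. On the other side, the weighted distances to any fixed vertex sum
  to the total edge length, so the same summation of \<open>B\<close> collapses to a combination of \<open>det D[S]\<close>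
  and its bordered determinant.
\<close>

section \<open>Determinants of tables\<close>

text \<open>Indexing by lists of labels turns replacing, deleting and repeating rows into list
  operations, and lets two matrices be compared through a relabelling.\<close>

definition table :: "('b \<Rightarrow> 'b \<Rightarrow> real) \<Rightarrow> 'b list \<Rightarrow> 'b list \<Rightarrow> real mat" where
  "table f xs ys = mat (length xs) (length ys) (\<lambda>(i, j). f (xs ! i) (ys ! j))"

lemma dim_table [simp]:
  "dim_row (table f xs ys) = length xs" "dim_col (table f xs ys) = length ys"
  by (auto simp: table_def)

lemma index_table [simp]:
  "i < length xs \<Longrightarrow> j < length ys \<Longrightarrow> table f xs ys $$ (i, j) = f (xs ! i) (ys ! j)"
  by (simp add: table_def)

lemma table_carrier: "length xs = n \<Longrightarrow> length ys = m \<Longrightarrow> table f xs ys \<in> carrier_mat n m"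
  by auto

lemma table_cong:
  assumes "\<And>x y. x \<in> set xs \<Longrightarrow> y \<in> set ys \<Longrightarrow> f x y = g x y"
  shows "table f xs ys = table g xs ys"
  by (rule eq_matI) (auto intro!: assms)

lemma table_map:
  "table f (map h xs) (map h ys) = table (\<lambda>x y. f (h x) (h y)) xs ys"
  by (rule eq_matI) auto

lemma transpose_table: "transpose_mat (table f xs ys) = table (\<lambda>x y. f y x) ys xs"
  by (rule eq_matI) auto

lemma det_table_swap:
  assumes "length xs = length ys"
  shows "det (table (\<lambda>x y. f y x) ys xs) = det (table f xs ys)"
  using det_transpose[OF table_carrier[OF refl assms[symmetric]], of f]
  by (simp add: transpose_table)

section \<open>Alternation and linearity in one row or column\<close>

lemma det_table_not_distinct_rows:
  assumes "length xs = length ys" "\<not> distinct xs"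
  shows "det (table f xs ys) = 0"
proof -
  obtain i j where ij: "i < length xs" "j < length xs" "i \<noteq> j" "xs ! i = xs ! j"
    using assms(2) by (auto simp: distinct_conv_nth)
  show ?thesis
  proof (rule det_identical_rows[of _ "length xs" i j])
    show "row (table f xs ys) i = row (table f xs ys) j"
      using ij by (intro eq_vecI) auto
  qed (use ij assms in auto)
qed

lemma det_table_not_distinct_cols:
  assumes "length xs = length ys" "\<not> distinct ys"
  shows "det (table f xs ys) = 0"
  using det_table_not_distinct_rows[of ys xs "\<lambda>x y. f y x"] det_table_swap[of xs ys f] assms
  by simp

text \<open>Only row \<open>i\<close> varies, so the Laplace cofactors along it are the same for
  every replacement and linearity can be read off. This later expands the label \<open>Total\<close>
  into vertices.\<close>

lemma det_table_row_sum:
  assumes len: "length xs = length ys" and i: "i < length xs"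
    and f: "\<And>y. y \<in> set ys \<Longrightarrow> f z y = (\<Sum>x\<in>I. c x * f (g x) y)"
  shows "det (table f (xs[i := z]) ys) = (\<Sum>x\<in>I. c x * det (table f (xs[i := g x]) ys))"
proof -
  let ?T = "\<lambda>x. table f (xs[i := x]) ys"
  have cof: "cofactor (?T x) i j = cofactor (?T z) i j" for x j
  proof -
    have "mat_delete (?T x) i j = mat_delete (?T z) i j"
      unfolding mat_delete_def using i
      by (intro eq_matI) auto
    then show ?thesis by (simp add: cofactor_def)
  qed
  have expand: "det (?T x) = (\<Sum>j<length ys. f x (ys ! j) * cofactor (?T z) i j)" for x
  proof -
    have "det (?T x) = (\<Sum>j<length ys. ?T x $$ (i, j) * cofactor (?T x) i j)"
      by (rule laplace_expansion_row) (use len i in auto)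
    also have "\<dots> = (\<Sum>j<length ys. f x (ys ! j) * cofactor (?T z) i j)"
      using i by (intro sum.cong refl) (simp add: cof[of x])
    finally show ?thesis .
  qed
  have "det (?T z) = (\<Sum>j<length ys. \<Sum>x\<in>I. c x * (f (g x) (ys ! j) * cofactor (?T z) i j))"
    unfolding expand by (intro sum.cong refl) (simp add: f sum_distrib_right mult.assoc)
  also have "\<dots> = (\<Sum>x\<in>I. c x * (\<Sum>j<length ys. f (g x) (ys ! j) * cofactor (?T z) i j))"
    by (subst sum.swap) (simp add: sum_distrib_left)
  finally show ?thesis by (simp only: expand[symmetric])
qed

lemma det_table_col_sum:
  assumes len: "length xs = length ys" and i: "i < length ys"
    and f: "\<And>x. x \<in> set xs \<Longrightarrow> f x z = (\<Sum>y\<in>I. c y * f x (g y))"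
  shows "det (table f xs (ys[i := z])) = (\<Sum>y\<in>I. c y * det (table f xs (ys[i := g y])))"
proof -
  have "det (table (\<lambda>x y. f y x) (ys[i := z]) xs) =
        (\<Sum>y\<in>I. c y * det (table (\<lambda>x y. f y x) (ys[i := g y]) xs))"
    by (rule det_table_row_sum) (use assms in auto)
  then show ?thesis using len by (subst (asm) (1 2) det_table_swap) auto
qed

section \<open>Minors, sparse lines and elementary operations\<close>

lemma mat_delete_table:
  "mat_delete (table f (xs1 @ x # xs2) (ys1 @ y # ys2)) (length xs1) (length ys1) =
   table f (xs1 @ xs2) (ys1 @ ys2)"
proof (rule eq_matI)
  fix i j
  assume "i < dim_row (table f (xs1 @ xs2) (ys1 @ ys2))"
    and "j < dim_col (table f (xs1 @ xs2) (ys1 @ ys2))"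
  then show "mat_delete (table f (xs1 @ x # xs2) (ys1 @ y # ys2)) (length xs1) (length ys1) $$ (i, j) =
      table f (xs1 @ xs2) (ys1 @ ys2) $$ (i, j)"
    by (simp add: mat_delete_def nth_append Suc_diff_le)
qed (auto simp: mat_delete_def)

lemma det_table_sparse_row:
  assumes len: "length xs1 + length xs2 = length ys1 + length ys2"
    and zero: "\<And>b. b \<in> set (ys1 @ ys2) \<Longrightarrow> f x b = 0"
  shows "det (table f (xs1 @ x # xs2) (ys1 @ y # ys2)) =
    (-1) ^ (length xs1 + length ys1) * f x y * det (table f (xs1 @ xs2) (ys1 @ ys2))"
proof -
  let ?xs = "xs1 @ x # xs2" and ?ys = "ys1 @ y # ys2" and ?k = "length xs1" and ?l = "length ys1"
  let ?M = "table f ?xs ?ys"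
  have "det ?M = (\<Sum>j<length ?ys. ?M $$ (?k, j) * cofactor ?M ?k j)"
    by (rule laplace_expansion_row) (use len in auto)
  also have "\<dots> = (\<Sum>j<length ?ys. if j = ?l then f x y * cofactor ?M ?k ?l else 0)"
  proof (intro sum.cong refl)
    fix j assume "j \<in> {..<length ?ys}"
    then consider "j = ?l" | "j < ?l" | k where "j = ?l + Suc k" "k < length ys2"
      by (metis add_Suc_right length_append length_Cons less_imp_Suc_add lessThan_iff
          linorder_neqE_nat nat_add_left_cancel_less Suc_less_eq)
    then show "?M $$ (?k, j) * cofactor ?M ?k j = (if j = ?l then f x y * cofactor ?M ?k ?l else 0)"
      by cases (auto simp: nth_append intro!: zero)
  qed
  also have "\<dots> = f x y * cofactor ?M ?k ?l" by (subst sum.delta) auto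
  also have "cofactor ?M ?k ?l = (-1) ^ (?k + ?l) * det (table f (xs1 @ xs2) (ys1 @ ys2))"
    by (simp add: cofactor_def mat_delete_table)
  finally show ?thesis by simp
qed

lemma det_table_sparse_col:
  assumes len: "length xs1 + length xs2 = length ys1 + length ys2"
    and zero: "\<And>a. a \<in> set (xs1 @ xs2) \<Longrightarrow> f a y = 0"
  shows "det (table f (xs1 @ x # xs2) (ys1 @ y # ys2)) =
    (-1) ^ (length xs1 + length ys1) * f x y * det (table f (xs1 @ xs2) (ys1 @ ys2))"
proof -
  have "det (table (\<lambda>x y. f y x) (ys1 @ y # ys2) (xs1 @ x # xs2)) =
    (-1) ^ (length ys1 + length xs1) * f x y * det (table (\<lambda>x y. f y x) (ys1 @ ys2) (xs1 @ xs2))"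
    by (rule det_table_sparse_row) (use assms in auto)
  moreover have "det (table (\<lambda>x y. f y x) (ys1 @ y # ys2) (xs1 @ x # xs2)) =
      det (table f (xs1 @ x # xs2) (ys1 @ y # ys2))"
    by (rule det_table_swap) (use len in simp)
  moreover have "det (table (\<lambda>x y. f y x) (ys1 @ ys2) (xs1 @ xs2)) = det (table f (xs1 @ xs2) (ys1 @ ys2))"
    by (rule det_table_swap) (use len in simp)
  ultimately show ?thesis by (simp add: add.commute)
qed

lemma nth_other_entry:
  assumes "i < length (xs1 @ x # xs2)" "i \<noteq> length xs1" "x \<notin> set (xs1 @ xs2)"
  shows "(xs1 @ x # xs2) ! i \<noteq> x"
proof (cases "i < length xs1")
  case True
  then have "(xs1 @ x # xs2) ! i \<in> set xs1" by (simp add: nth_append)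
  then show ?thesis using assms(3) by auto
next
  case False
  then have "length xs1 < i" using assms(2) by simp
  then obtain k where "i = length xs1 + Suc k" by (auto dest: less_imp_Suc_add)
  then have "(xs1 @ x # xs2) ! i \<in> set xs2" using assms(1) by (simp add: nth_append)
  then show ?thesis using assms(3) by auto
qed

text \<open>\<open>x\<close> and \<open>y\<close> each occur once, at the same position, so a single
  diagonal entry changes. The determinant is affine in that entry, and its slope is the
  complementary minor, with sign +1 on the diagonal.\<close>

lemma det_table_change_entry:
  assumes len: "length xs1 = length ys1" "length xs2 = length ys2"
    and agree: "\<And>a b. a \<noteq> x \<or> b \<noteq> y \<Longrightarrow> f' a b = f a b"
    and x: "x \<notin> set (xs1 @ xs2)" and y: "y \<notin> set (ys1 @ ys2)"
  shows "det (table f' (xs1 @ x # xs2) (ys1 @ y # ys2)) =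
    det (table f (xs1 @ x # xs2) (ys1 @ y # ys2)) +
    (f' x y - f x y) * det (table f (xs1 @ xs2) (ys1 @ ys2))"
proof -
  let ?xs = "xs1 @ x # xs2" and ?ys = "ys1 @ y # ys2" and ?k = "length ys1"
  have cof: "cofactor (table f' ?xs ?ys) ?k j = cofactor (table f ?xs ?ys) ?k j" for j
  proof -
    have before: "?xs ! i \<noteq> x" if "i < ?k" for i
      using nth_other_entry[of i xs1 x xs2] that x len by simp
    have after: "?xs ! Suc i \<noteq> x" if "i < ?k + length ys2" "\<not> i < ?k" for i
      using nth_other_entry[of "Suc i" xs1 x xs2] that x len by simp
    have "mat_delete (table f' ?xs ?ys) ?k j = mat_delete (table f ?xs ?ys) ?k j"
      unfolding mat_delete_def
      using len by (intro eq_matI) (auto intro!: agree simp: before after)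
    then show ?thesis by (simp add: cofactor_def)
  qed
  have cofk: "cofactor (table f ?xs ?ys) ?k ?k = det (table f (xs1 @ xs2) (ys1 @ ys2))"
    using mat_delete_table[of f xs1 x xs2 ys1 y ys2] len by (simp add: cofactor_def)
  have entry: "f' x (?ys ! j) = f x (?ys ! j) + (if j = ?k then f' x y - f x y else 0)"
    if "j < length ?ys" for j
  proof (cases "j = ?k")
    case False
    then have "?ys ! j \<noteq> y"
      using nth_other_entry[of j ys1 y ys2] that y by simp
    then show ?thesis using False agree by simp
  qed simp
  have expand: "det (table h ?xs ?ys) =
      (\<Sum>j<length ?ys. h x (?ys ! j) * cofactor (table h ?xs ?ys) ?k j)" for h
  proof -
    have "det (table h ?xs ?ys) =
        (\<Sum>j<length ?ys. table h ?xs ?ys $$ (?k, j) * cofactor (table h ?xs ?ys) ?k j)"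
      by (rule laplace_expansion_row) (use len in auto)
    also have "\<dots> = (\<Sum>j<length ?ys. h x (?ys ! j) * cofactor (table h ?xs ?ys) ?k j)"
      using len by (intro sum.cong refl) (simp add: nth_append)
    finally show ?thesis .
  qed
  have "det (table f' ?xs ?ys) = (\<Sum>j<length ?ys. f x (?ys ! j) * cofactor (table f ?xs ?ys) ?k j +
      (if j = ?k then (f' x y - f x y) * cofactor (table f ?xs ?ys) ?k ?k else 0))"
    unfolding expand[of f'] cof by (intro sum.cong refl) (auto simp: entry algebra_simps)
  also have "\<dots> = det (table f ?xs ?ys) + (f' x y - f x y) * det (table f (xs1 @ xs2) (ys1 @ ys2))"
    unfolding cofk sum.distrib expand[of f] by simp
  finally show ?thesis .
qed

text \<open>Row operations with the first row as pivot amount to left multiplication by a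
  unitriangular matrix, of determinant 1. In the applications the pivot is the border row.\<close>

lemma det_table_add_head_row:
  assumes len: "length ys = Suc (length xs)" and "z \<notin> set xs"
    and f': "\<And>x y. f' x y = f x y + (if x = z then 0 else c x * f z y)"
  shows "det (table f' (z # xs) ys) = det (table f (z # xs) ys)"
proof -
  let ?n = "length ys"
  \<comment> \<open>The identity matrix with the coefficients \<open>c\<close> written into its
    first column below the diagonal.\<close>
  define T where "T = mat ?n ?n (\<lambda>(i, j). if i = j then 1 else if j = 0 then c ((z # xs) ! i) else 0)"
  have z: "xs ! i \<noteq> z" if "i < length xs" for i
    using that assms(2) by (metis nth_mem)
  have T: "T \<in> carrier_mat ?n ?n" by (simp add: T_def)
  have "det T = prod_list (diag_mat T)"
    by (rule det_lower_triangular[OF _ T]) (auto simp: T_def)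
  also have "diag_mat T = replicate ?n 1"
    by (intro nth_equalityI) (auto simp: diag_mat_def T_def)
  finally have "det T = 1" by simp
  have "T * table f (z # xs) ys = table f' (z # xs) ys"
  proof (rule eq_matI)
    fix i j
    assume "i < dim_row (table f' (z # xs) ys)" "j < dim_col (table f' (z # xs) ys)"
    then have ij: "i < ?n" "j < ?n" using len by auto
    have "(T * table f (z # xs) ys) $$ (i, j) =
        (\<Sum>k\<in>{0..<?n}. (if i = k then 1 else if k = 0 then c ((z # xs) ! i) else 0) * f ((z # xs) ! k) (ys ! j))"
      using ij len by (simp add: T_def scalar_prod_def)
    also have "\<dots> = (\<Sum>k\<in>{0..<?n}. (if i = k then f ((z # xs) ! i) (ys ! j) else 0) +
          (if k = 0 then if i = 0 then 0 else c ((z # xs) ! i) * f z (ys ! j) else 0))"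
      by (intro sum.cong refl) auto
    also have "\<dots> = f ((z # xs) ! i) (ys ! j) + (if i = 0 then 0 else c ((z # xs) ! i) * f z (ys ! j))"
    proof -
      have "i \<in> {0..<?n}" "0 \<in> {0..<?n}" using ij by auto
      then show ?thesis
        by (simp only: sum.distrib sum.delta sum.delta' finite_atLeastLessThan if_True)
    qed
    also have "\<dots> = f' ((z # xs) ! i) (ys ! j)"
      using ij len by (cases i) (auto simp: f' z)
    finally show "(T * table f (z # xs) ys) $$ (i, j) = table f' (z # xs) ys $$ (i, j)"
      using ij len by simp
  qed (use len in \<open>auto simp: T_def\<close>)
  then show ?thesis
    using det_mult[OF T table_carrier[of "z # xs" ?n ys ?n f]] len \<open>det T = 1\<close> by simp
qed

lemma det_table_add_head_col:
  assumes "length xs = Suc (length ys)" and "z \<notin> set ys"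
    and "\<And>x y. f' x y = f x y + (if y = z then 0 else c y * f x z)"
  shows "det (table f' xs (z # ys)) = det (table f xs (z # ys))"
proof -
  have "det (table (\<lambda>x y. f' y x) (z # ys) xs) = det (table (\<lambda>x y. f y x) (z # ys) xs)"
    by (rule det_table_add_head_row) (use assms in auto)
  then show ?thesis using assms(1) by (subst (asm) (1 2) det_table_swap) auto
qed

section \<open>Linked vertices and growing a tree by leaves\<close>

definition linked :: "'a set set \<Rightarrow> 'a \<Rightarrow> 'a \<Rightarrow> bool" where
  "linked A x y \<longleftrightarrow> (\<exists>p. is_path A x y p)"

lemma is_path_prefix: "is_path A x y (p1 @ z # p2) \<Longrightarrow> is_path A x z (p1 @ [z])"
  by (cases p1) (auto simp: is_path_def successively_append_iff successively_Cons hd_append)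

lemma is_path_mono: "is_path A x y p \<Longrightarrow> A \<subseteq> B \<Longrightarrow> is_path B x y p"
  unfolding is_path_def using successively_mono[of "\<lambda>x y. {x, y} \<in> A" p "\<lambda>x y. {x, y} \<in> B"] by blast

lemma is_path_rtrancl:
  assumes "is_path A x y p"
  shows "(x, y) \<in> {(a, b). {a, b} \<in> A}\<^sup>*"
  using assms
proof (induction p arbitrary: x)
  case (Cons z p)
  show ?case
  proof (cases p)
    case Nil
    then show ?thesis using Cons.prems by (auto simp: is_path_def)
  next
    case (Cons z' p')
    then have "is_path A z' y p" and "(x, z') \<in> {(a, b). {a, b} \<in> A}"
      using Cons.prems by (auto simp: is_path_def)
    then show ?thesis using Cons.IH by (meson converse_rtrancl_into_rtrancl)
  qed
qed (simp add: is_path_def)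

text \<open>Walks suffice: when a further edge returns to a vertex already on the path, the prefix
  ending there is a simple path. The closure supplies transitivity and induction, which simple paths
  do not offer directly.\<close>

lemma linked_iff_rtrancl: "linked A x y \<longleftrightarrow> (x, y) \<in> {(a, b). {a, b} \<in> A}\<^sup>*"
proof
  assume "(x, y) \<in> {(a, b). {a, b} \<in> A}\<^sup>*"
  then show "linked A x y"
  proof induction
    case base
    have "is_path A x x [x]" by (simp add: is_path_def)
    then show ?case unfolding linked_def by blast
  next
    case (step y z)
    then obtain p where p: "is_path A x y p" by (auto simp: linked_def)
    show ?case
    proof (cases "z \<in> set p")
      case True
      then obtain p1 p2 where "p = p1 @ z # p2" by (meson split_list)
      then have "is_path A x z (p1 @ [z])" using p is_path_prefix by metis
      then show ?thesis unfolding linked_def by blast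
    next
      case False
      then have "is_path A x z (p @ [z])"
        using p step.hyps by (auto simp: is_path_def successively_append_iff)
      then show ?thesis unfolding linked_def by blast
    qed
  qed
qed (auto simp: linked_def dest: is_path_rtrancl)

lemma linked_refl [simp]: "linked A x x"
  by (simp add: linked_iff_rtrancl)

lemma linked_trans: "linked A x y \<Longrightarrow> linked A y z \<Longrightarrow> linked A x z"
  by (simp add: linked_iff_rtrancl)

lemma linked_sym: "linked A x y \<longleftrightarrow> linked A y x"
proof -
  have "sym {(a, b). {a, b} \<in> A}" by (auto intro!: symI simp: insert_commute)
  then show ?thesis
    unfolding linked_iff_rtrancl by (meson sym_rtrancl symD)
qed

lemma linked_edge: "{x, y} \<in> A \<Longrightarrow> linked A x y"
  unfolding linked_iff_rtrancl by auto

lemma linked_mono: "linked A x y \<Longrightarrow> A \<subseteq> B \<Longrightarrow> linked B x y"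
  unfolding linked_iff_rtrancl by (erule rtrancl_mono[THEN subsetD, rotated]) auto

lemma linked_closed:
  assumes "linked A x y" "x \<in> V" "\<And>e. e \<in> A \<Longrightarrow> e \<subseteq> V"
  shows "y \<in> V"
  using assms(1,2) unfolding linked_iff_rtrancl
  by (induction rule: rtrancl_induct) (use assms(3) in auto)

lemma linked_outside:
  assumes "v \<notin> \<Union>A"
  shows "linked A v y \<longleftrightarrow> y = v" "linked A y v \<longleftrightarrow> y = v"
proof -
  show "linked A v y \<longleftrightarrow> y = v"
    unfolding linked_iff_rtrancl using assms by (auto elim: converse_rtranclE)
  then show "linked A y v \<longleftrightarrow> y = v" using linked_sym by metis
qed

text \<open>Contraction of a leaf edge: \<open>v\<close> is moved onto its neighbour
  \<open>q\<close>, all other vertices stay.\<close>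

abbreviation fold_leaf :: "'a \<Rightarrow> 'a \<Rightarrow> 'a \<Rightarrow> 'a" where
  "fold_leaf v q \<equiv> id(v := q)"

text \<open>The new edge is the only one at \<open>v\<close> and collapses to a point under the
  contraction, so it creates no link between old vertices.\<close>

lemma linked_insert_leaf:
  assumes "v \<notin> \<Union>A" "v \<noteq> q"
  shows "linked (insert {v, q} A) x y \<longleftrightarrow> linked A (fold_leaf v q x) (fold_leaf v q y)"
proof
  assume "linked (insert {v, q} A) x y"
  then show "linked A (fold_leaf v q x) (fold_leaf v q y)"
    unfolding linked_iff_rtrancl[of "insert _ _"]
  proof induction
    case (step y z)
    from step.hyps(2) consider "{y, z} = {v, q}" | "{y, z} \<in> A" by auto
    then show ?case
    proof cases
      case 1
      then have "fold_leaf v q y = fold_leaf v q z" by (auto simp: doubleton_eq_iff)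
      then show ?thesis using step.IH by (simp only:)
    next
      case 2
      then have "y \<noteq> v" "z \<noteq> v" using assms(1) by auto
      then show ?thesis using step.IH linked_edge[OF 2] by (auto intro: linked_trans)
    qed
  qed simp
next
  have fold: "linked (insert {v, q} A) x (fold_leaf v q x)" for x
    by (auto intro: linked_edge)
  assume "linked A (fold_leaf v q x) (fold_leaf v q y)"
  then show "linked (insert {v, q} A) x y"
    by (meson fold linked_mono linked_sym linked_trans subset_insertI)
qed

text \<open>Provides induction on leaves, on which the later facts about paths, distances, forests
  and vertex weights rest.\<close>

inductive grown_tree :: "'a set \<Rightarrow> 'a set set \<Rightarrow> bool" where
  single: "grown_tree {r} {}"
| leaf: "grown_tree V E \<Longrightarrow> v \<notin> V \<Longrightarrow> q \<in> V \<Longrightarrow> grown_tree (insert v V) (insert {v, q} E)"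

lemma grown_tree_finite: "grown_tree V E \<Longrightarrow> finite V \<and> finite E"
  by (induction rule: grown_tree.induct) auto

lemma grown_tree_edge_subset: "grown_tree V E \<Longrightarrow> e \<in> E \<Longrightarrow> e \<subseteq> V"
  by (induction rule: grown_tree.induct) auto

lemma grown_tree_linked: "grown_tree V E \<Longrightarrow> x \<in> V \<Longrightarrow> y \<in> V \<Longrightarrow> linked E x y"
proof (induction arbitrary: x y rule: grown_tree.induct)
  case (leaf V E v q)
  have "v \<notin> \<Union>E" "v \<noteq> q" using grown_tree_edge_subset[OF leaf.hyps(1)] leaf.hyps by auto
  then show ?case using leaf by (auto simp: linked_insert_leaf)
qed simp

text \<open>A maximal grown subtree spans the tree, since an edge leaving it would enlarge it; and it
  has all edges, since a missing edge would close a cycle.\<close>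

lemma finite_tree_grown:
  assumes "finite_tree V E"
  shows "grown_tree V E"
proof -
  have fin: "finite V" and E: "\<And>e. e \<in> E \<Longrightarrow> e \<subseteq> V \<and> card e = 2" and "V \<noteq> {}"
    and conn: "\<And>u v. u \<in> V \<Longrightarrow> v \<in> V \<Longrightarrow> linked E u v" and acyc: "acyclic_graph E"
    using assms
    by (auto simp: finite_tree_def finite_graph_def connected_graph_def linked_def)
  define P where "P W \<longleftrightarrow> W \<subseteq> V \<and> (\<exists>F\<subseteq>E. grown_tree W F)" for W
  obtain r where "r \<in> V" using \<open>V \<noteq> {}\<close> by blast
  then have "P {r}" unfolding P_def by (auto intro: grown_tree.single)
  moreover have "P W \<Longrightarrow> card W \<le> card V" for W
    unfolding P_def using fin by (auto intro: card_mono)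
  ultimately have "\<exists>W. P W \<and> (\<forall>W'. P W' \<longrightarrow> card W' \<le> card W)"
    by (intro ex_has_greatest_nat[where b = "Suc (card V)"]) (auto simp: less_Suc_eq_le)
  then obtain W where W: "P W" and max: "\<And>W'. P W' \<Longrightarrow> card W' \<le> card W" by metis
  obtain F where F: "F \<subseteq> E" "grown_tree W F" and "W \<subseteq> V" using W by (auto simp: P_def)
  have "finite W" using \<open>W \<subseteq> V\<close> fin finite_subset by blast
  obtain s where "s \<in> W" using F(2) by (cases rule: grown_tree.cases) auto
  have "y \<in> W" if "y \<in> V" for y
  proof -
    have "(s, y) \<in> {(a, b). {a, b} \<in> E}\<^sup>*"
      using conn \<open>s \<in> W\<close> \<open>W \<subseteq> V\<close> that by (auto simp: linked_iff_rtrancl[symmetric])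
    then show ?thesis
    proof induction
      case (step y z)
      show ?case
      proof (rule ccontr)
        assume "z \<notin> W"
        then have "grown_tree (insert z W) (insert {z, y} F)"
          using F(2) step.IH by (intro grown_tree.leaf)
        moreover have "z \<in> V" "{z, y} \<in> E" using step.hyps E by (auto simp: insert_commute)
        ultimately have "P (insert z W)"
          unfolding P_def using F(1) \<open>W \<subseteq> V\<close> by blast
        then show False using max[of "insert z W"] \<open>z \<notin> W\<close> \<open>finite W\<close> by simp
      qed
    qed (use \<open>s \<in> W\<close> in simp)
  qed
  then have "W = V" using \<open>W \<subseteq> V\<close> by blast
  have "e \<in> F" if "e \<in> E" for e
  proof (rule ccontr)
    assume "e \<notin> F"
    obtain x y where xy: "e = {x, y}" "x \<noteq> y" using E[OF \<open>e \<in> E\<close>] by (meson card_2_iff)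
    then have "x \<in> W" "y \<in> W" using E[OF \<open>e \<in> E\<close>] \<open>W = V\<close> by auto
    then obtain p where p: "is_path F x y p"
      using grown_tree_linked[OF F(2)] by (auto simp: linked_def)
    \<comment> \<open>One vertex would force \<open>x = y\<close>, and two would put
      \<open>e\<close> itself into \<open>F\<close>; any longer path is closed to a cycle by
      \<open>e\<close>.\<close>
    have "length p \<ge> 3"
    proof (rule ccontr)
      assume "\<not> length p \<ge> 3"
      then have "length p = 0 \<or> length p = 1 \<or> length p = 2" by arith
      then show False using p xy \<open>e \<notin> F\<close>
        by (auto simp: is_path_def length_Suc_conv numeral_2_eq_2)
    qed
    then have "is_cycle E p"
      using is_path_mono[OF p F(1)] xy(1) \<open>e \<in> E\<close>
      by (simp add: is_cycle_def is_path_def insert_commute)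
    then show False using acyc by (simp add: acyclic_graph_def)
  qed
  then have "F = E" using F(1) by blast
  then show ?thesis using F(2) \<open>W = V\<close> by simp
qed

section \<open>Distances in a grown tree\<close>

lemma is_path_rev:
  assumes "is_path E x y p"
  shows "is_path E y x (rev p)"
  using assms unfolding is_path_def
  by (auto simp: hd_rev last_rev insert_commute)

lemma is_path_rev_iff: "is_path E x y (rev p) \<longleftrightarrow> is_path E y x p"
  using is_path_rev[of E x y "rev p"] is_path_rev[of E y x p] by auto

lemma path_edges_Nil [simp]: "path_edges [] = {}"
  and path_edges_single [simp]: "path_edges [x] = {}"
  by (auto simp: path_edges_def)

lemma path_edges_Cons_Cons [simp]:
  "path_edges (x # y # p) = insert {x, y} (path_edges (y # p))"
proof (intro equalityI subsetI)
  fix e assume "e \<in> path_edges (x # y # p)"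
  then obtain i where "e = {(x # y # p) ! i, (x # y # p) ! Suc i}" "Suc i < length (x # y # p)"
    unfolding path_edges_def by blast
  then show "e \<in> insert {x, y} (path_edges (y # p))"
    by (cases i) (auto simp: path_edges_def)
next
  fix e assume "e \<in> insert {x, y} (path_edges (y # p))"
  then consider "e = {x, y}" | i where "e = {(y # p) ! i, (y # p) ! Suc i}" "Suc i < length (y # p)"
    unfolding path_edges_def by blast
  then show "e \<in> path_edges (x # y # p)"
  proof cases
    case 1
    then have "e = {(x # y # p) ! 0, (x # y # p) ! Suc 0}" by simp
    then show ?thesis unfolding path_edges_def by fastforce
  next
    case 2
    then have "e = {(x # y # p) ! Suc i, (x # y # p) ! Suc (Suc i)}" "Suc (Suc i) < length (x # y # p)"
      by auto
    then show ?thesis unfolding path_edges_def by blast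
  qed
qed

lemma path_edges_snoc:
  "p \<noteq> [] \<Longrightarrow> path_edges (p @ [x]) = insert {last p, x} (path_edges p)"
  by (induction p rule: induct_list012) auto

lemma path_edges_rev: "path_edges (rev p) = path_edges p"
proof (induction p rule: induct_list012)
  case (3 x y zs)
  have "path_edges (rev (x # y # zs)) = path_edges (rev (y # zs) @ [x])" by simp
  also have "\<dots> = insert {y, x} (path_edges (rev (y # zs)))"
    by (subst path_edges_snoc) auto
  finally show ?case using 3 by (simp add: insert_commute)
qed auto

lemma path_edges_subset: "successively (\<lambda>x y. {x, y} \<in> E) p \<Longrightarrow> path_edges p \<subseteq> E"
  by (induction p rule: induct_list012) auto

lemma finite_path_edges: "finite (path_edges p)"
  by (induction p rule: induct_list012) auto

text \<open>\<open>tree_dist\<close> picks its path by \<open>THE\<close>, so uniqueness is what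
  identifies the two chosen paths as reversals of each other; reversal keeps the edge set.\<close>

lemma tree_dist_sym: 
  assumes "\<exists>!p. is_path E x y p"
  shows "tree_dist E \<alpha> y x = tree_dist E \<alpha> x y"
proof -
  obtain p where p: "is_path E x y p" "\<And>p'. is_path E x y p' \<Longrightarrow> p' = p" using assms by auto
  then have "(THE p. is_path E x y p) = p" by blast
  moreover have "(THE p. is_path E y x p) = rev p"
    using p by (metis is_path_rev_iff rev_rev_ident the_equality)
  ultimately show ?thesis by (simp add: tree_dist_def path_edges_rev)
qed

lemma is_path_same: "is_path E x x p \<longleftrightarrow> p = [x]"
  by (cases p) (auto simp: is_path_def)

lemma tree_dist_same: "tree_dist E \<alpha> x x = 0"
  by (simp add: tree_dist_def is_path_same)

section \<open>Paths and distances after attaching a leaf\<close>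

context
  fixes v q :: 'a and V :: "'a set" and E :: "'a set set"
  assumes v: "v \<notin> V" and q: "q \<in> V" and E: "\<And>e. e \<in> E \<Longrightarrow> e \<subseteq> V"
begin

lemma leaf_edge: "{v, x} \<in> insert {v, q} E \<longleftrightarrow> x = q" "{x, v} \<in> insert {v, q} E \<longleftrightarrow> x = q"
  using v E q by (auto simp: doubleton_eq_iff)

text \<open>A path between old vertices that visited \<open>v\<close> would have to enter and leave
  through \<open>q\<close>, the only neighbour of \<open>v\<close>, and so would repeat
  \<open>q\<close>.\<close>

lemma is_path_insert_leaf:
  assumes "x \<in> V" "y \<in> V"
  shows "is_path (insert {v, q} E) x y p \<longleftrightarrow> is_path E x y p"
proof
  assume p: "is_path (insert {v, q} E) x y p"
  have "v \<notin> set p"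
  proof
    assume "v \<in> set p"
    then obtain p1 p2 where p12: "p = p1 @ v # p2" by (meson split_list)
    have "p1 \<noteq> []" "p2 \<noteq> []" using p p12 assms v by (auto simp: is_path_def)
    then have "last p1 = q" "hd p2 = q"
      using p p12 by (auto simp del: insert_iff
          simp: is_path_def successively_append_iff successively_Cons leaf_edge)
    then have "q \<in> set p1 \<inter> set p2"
      using \<open>p1 \<noteq> []\<close> \<open>p2 \<noteq> []\<close> by (metis IntI hd_in_set last_in_set)
    then show False using p p12 by (auto simp: is_path_def)
  qed
  then have "successively (\<lambda>x y. {x, y} \<in> insert {v, q} E) p = successively (\<lambda>x y. {x, y} \<in> E) p"
    by (intro successively_cong refl) (auto simp: doubleton_eq_iff)
  then show "is_path E x y p" using p unfolding is_path_def by blast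
qed (auto intro: is_path_mono)

lemma is_path_from_leaf:
  assumes "y \<in> V"
  shows "is_path (insert {v, q} E) v y p \<longleftrightarrow> (\<exists>p'. p = v # p' \<and> is_path E q y p')"
proof
  assume p: "is_path (insert {v, q} E) v y p"
  then obtain p' where p': "p = v # p'" by (cases p) (auto simp: is_path_def)
  have "p' \<noteq> []" using p p' assms v by (auto simp: is_path_def)
  then have "is_path (insert {v, q} E) q y p'"
    using p p' by (auto simp del: insert_iff simp: is_path_def successively_Cons leaf_edge)
  then show "\<exists>p'. p = v # p' \<and> is_path E q y p'"
    using p' is_path_insert_leaf[OF q assms] by blast
next
  assume "\<exists>p'. p = v # p' \<and> is_path E q y p'"
  then obtain p' where p': "p = v # p'" "is_path E q y p'" by blast
  \<comment> \<open>Each vertex of \<open>p'\<close> is reached from \<open>q\<close> by old edges,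
    hence is old; prepending \<open>v\<close> therefore keeps the list distinct.\<close>
  have "set p' \<subseteq> V"
  proof
    fix z assume "z \<in> set p'"
    then obtain p1 p2 where "p' = p1 @ z # p2" by (meson split_list)
    then have "is_path E q z (p1 @ [z])" using p'(2) is_path_prefix by metis
    then show "z \<in> V" using linked_closed[of E q z V] q E by (auto simp: linked_def)
  qed
  moreover have "is_path (insert {v, q} E) q y p'" 
    by (rule is_path_mono[OF p'(2)]) auto
  ultimately show "is_path (insert {v, q} E) v y p"
    using p'(1) v by (auto simp: is_path_def successively_Cons)
qed

end

lemma grown_tree_unique_path:
  "grown_tree V E \<Longrightarrow> x \<in> V \<Longrightarrow> y \<in> V \<Longrightarrow> \<exists>!p. is_path E x y p"
proof (induction arbitrary: x y rule: grown_tree.induct)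
  case (single r)
  then show ?case by (simp add: is_path_same)
next
  case (leaf V E v q)
  note E = grown_tree_edge_subset[OF leaf.hyps(1)]
  note old = is_path_insert_leaf[OF leaf.hyps(2,3) E]
  note new = is_path_from_leaf[OF leaf.hyps(2,3) E]
  have from_v: "\<exists>!p. is_path (insert {v, q} E) v y p" if "y \<in> V" for y
    using leaf.IH[OF leaf.hyps(3) that] by (simp add: new[OF _ that]) blast
  have to_v: "\<exists>!p. is_path (insert {v, q} E) y v p" if "y \<in> V" for y
    using from_v[OF that] is_path_rev_iff[of "insert {v, q} E" y v] by (metis rev_rev_ident)
  show ?case
    using leaf.prems leaf.IH from_v to_v
    by (cases "x = v"; cases "y = v") (auto simp: is_path_same old)
qed

text \<open>Each end at \<open>v\<close> adds the new edge once; if both ends are \<open>v\<close>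
  the distance is 0 and the last term cancels both additions. In this form every change except the
  one at \<open>(v, v)\<close> depends on one end only.\<close>

lemma tree_dist_insert_leaf:
  fixes \<alpha> :: "'a set \<Rightarrow> real"
  assumes tree: "grown_tree V E" and v: "v \<notin> V" and q: "q \<in> V"
    and x: "x \<in> insert v V" and y: "y \<in> insert v V"
  defines "\<pi> \<equiv> fold_leaf v q" and "a \<equiv> \<alpha> {v, q}"
  shows "tree_dist (insert {v, q} E) \<alpha> x y = tree_dist E \<alpha> (\<pi> x) (\<pi> y) +
    a * of_bool (x = v) + a * of_bool (y = v) - 2 * a * of_bool (x = v \<and> y = v)"
proof -
  let ?E = "insert {v, q} E"
  note E = grown_tree_edge_subset[OF tree]
  have old: "tree_dist ?E \<alpha> x y = tree_dist E \<alpha> x y" if "x \<in> V" "y \<in> V" for x y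
  proof -
    have "is_path ?E x y = is_path E x y"
      by (intro ext is_path_insert_leaf[OF v q E that])
    then show ?thesis by (simp add: tree_dist_def)
  qed
  have from_v: "tree_dist ?E \<alpha> v y = tree_dist E \<alpha> q y + a" if y: "y \<in> V" for y
  proof -
    obtain p where p: "is_path E q y p" and iff: "\<And>p'. is_path E q y p' \<longleftrightarrow> p' = p"
      using grown_tree_unique_path[OF tree q y] by metis
    have the_p: "(THE p. is_path E q y p) = p" by (simp add: iff)
    have the_vp: "(THE p. is_path ?E v y p) = v # p"
      by (simp add: is_path_from_leaf[OF v q E y] iff)
    have "path_edges (v # p) = insert {v, q} (path_edges p)"
      using p by (cases p) (auto simp: is_path_def)
    moreover have "{v, q} \<notin> path_edges p"
    proof -
      have "path_edges p \<subseteq> E" using p by (intro path_edges_subset) (simp add: is_path_def)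
      then show ?thesis using E[of "{v, q}"] v by auto
    qed
    ultimately show ?thesis
      unfolding tree_dist_def the_p the_vp by (simp add: finite_path_edges a_def)
  qed
  have to_v: "tree_dist ?E \<alpha> y v = tree_dist E \<alpha> y q + a" if y: "y \<in> V" for y
  proof -
    have "tree_dist ?E \<alpha> y v = tree_dist ?E \<alpha> v y"
      by (rule tree_dist_sym, rule grown_tree_unique_path[OF grown_tree.leaf[OF tree v q]])
        (use y in auto)
    moreover have "tree_dist E \<alpha> q y = tree_dist E \<alpha> y q"
      by (rule tree_dist_sym, rule grown_tree_unique_path[OF tree]) (use y q in auto)
    ultimately show ?thesis using from_v[OF y] by simp
  qed
  show ?thesis
    using x y v unfolding \<pi>_def
    by (cases "x = v"; cases "y = v") (simp_all add: tree_dist_same old from_v to_v)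
qed

section \<open>Bordered distance determinants count rooted forests\<close>

text \<open>Every component contains exactly one root, where roots are counted as list entries.
  Multiplicity matters: contracting a leaf can send two roots to the same vertex, and the resulting
  list must fail.\<close>

definition meets_once :: "'a set \<Rightarrow> 'a set set \<Rightarrow> 'a list \<Rightarrow> bool" where
  "meets_once V A rs \<longleftrightarrow> (\<forall>x\<in>V. length (filter (linked A x) rs) = 1)"

text \<open>An indicator over all edge subsets is enough, because every edge subset of a tree is a
  spanning forest; conditions can then be rewritten without touching the index set.\<close>

definition coweight_sum :: "'a set set \<Rightarrow> ('a set \<Rightarrow> real) \<Rightarrow> ('a set set \<Rightarrow> bool) \<Rightarrow> real" where
  "coweight_sum E \<alpha> P = (\<Sum>A\<in>Pow E. of_bool (P A) * coweight E \<alpha> A)"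

lemma coweight_sum_cong:
  "(\<And>A. A \<subseteq> E \<Longrightarrow> P A \<longleftrightarrow> Q A) \<Longrightarrow> coweight_sum E \<alpha> P = coweight_sum E \<alpha> Q"
  unfolding coweight_sum_def by (intro sum.cong refl) simp

lemma coweight_sum_False: "(\<And>A. A \<subseteq> E \<Longrightarrow> \<not> P A) \<Longrightarrow> coweight_sum E \<alpha> P = 0"
  unfolding coweight_sum_def by (intro sum.neutral) simp

lemma coweight_sum_insert:
  assumes "finite E" "e \<notin> E"
  shows "coweight_sum (insert e E) \<alpha> P =
    coweight_sum E \<alpha> (\<lambda>A. P (insert e A)) + \<alpha> e * coweight_sum E \<alpha> P"
proof -
  let ?t = "\<lambda>A. of_bool (P A) * coweight (insert e E) \<alpha> A"
  have "inj_on (insert e) (Pow E)"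
    using assms(2) by (auto simp: inj_on_def)
  then have "(\<Sum>A\<in>insert e ` Pow E. ?t A) = (\<Sum>A\<in>Pow E. ?t (insert e A))"
    by (subst sum.reindex) (simp_all only: comp_def)
  moreover have "coweight_sum (insert e E) \<alpha> P = (\<Sum>A\<in>Pow E. ?t A) + (\<Sum>A\<in>insert e ` Pow E. ?t A)"
    unfolding coweight_sum_def Pow_insert by (rule sum.union_disjoint) (use assms in auto)
  ultimately have "coweight_sum (insert e E) \<alpha> P = (\<Sum>A\<in>Pow E. ?t A) + (\<Sum>A\<in>Pow E. ?t (insert e A))"
    by simp
  also have "(\<Sum>A\<in>Pow E. ?t (insert e A)) = coweight_sum E \<alpha> (\<lambda>A. P (insert e A))"
    unfolding coweight_sum_def
  proof (intro sum.cong refl)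
    fix A assume "A \<in> Pow E"
    then have "insert e E - insert e A = E - A" using assms(2) by blast
    then show "?t (insert e A) = of_bool (P (insert e A)) * coweight E \<alpha> A"
      by (simp add: coweight_def)
  qed
  also have "(\<Sum>A\<in>Pow E. ?t A) = \<alpha> e * coweight_sum E \<alpha> P"
    unfolding coweight_sum_def sum_distrib_left
  proof (intro sum.cong refl)
    fix A assume "A \<in> Pow E"
    then have "insert e E - A = insert e (E - A)" using assms(2) by blast
    then show "?t A = \<alpha> e * (of_bool (P A) * coweight E \<alpha> A)"
      using assms by (simp add: coweight_def)
  qed
  finally show ?thesis by simp
qed

section \<open>Conditions on root lists, with and without a new leaf edge\<close>

lemma meets_once_distinct:
  assumes "meets_once V A rs" "set rs \<subseteq> V"
  shows "distinct rs"
proof (rule ccontr)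
  assume "\<not> distinct rs"
  then obtain p x m s where rs: "rs = p @ [x] @ m @ [x] @ s"
    by (meson not_distinct_decomp)
  then have "length (filter (linked A x) rs) = 1"
    using assms unfolding meets_once_def by auto
  then show False by (simp add: rs)
qed

lemma meets_once_head:
  assumes "meets_once V A (u # ss)" "u \<in> V" "linked A u w"
  shows "w \<notin> set ss"
  using assms unfolding meets_once_def by (auto simp: filter_empty_conv)

text \<open>The new edge puts \<open>v\<close> into the component of \<open>q\<close>, so
  contracting it does not affect the count of roots.\<close>

lemma meets_once_insert_leaf:
  assumes "v \<notin> \<Union>A" "v \<notin> V" "q \<in> V"
  shows "meets_once (insert v V) (insert {v, q} A) rs \<longleftrightarrow> meets_once V A (map (fold_leaf v q) rs)"
proof -
  have "v \<noteq> q" using assms by auto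
  have 1: "length (filter (linked (insert {v, q} A) x) rs) =
      length (filter (linked A (fold_leaf v q x)) (map (fold_leaf v q) rs))" for x
    unfolding filter_map length_map comp_def linked_insert_leaf[OF assms(1) \<open>v \<noteq> q\<close>] ..
  have "fold_leaf v q x = x" if "x \<in> V" for x using that assms(2) by auto
  then show ?thesis
    unfolding meets_once_def 1 using assms(3) by auto
qed

lemma filter_split_off:
  assumes "v \<notin> set (p @ s)"
  shows "filter (\<lambda>y. y = v) (p @ v # s) = [v]" "filter (\<lambda>y. y \<noteq> v) (p @ v # s) = p @ s"
proof -
  have "filter (\<lambda>y. y = v) (p @ s) = []" "filter (\<lambda>y. y \<noteq> v) (p @ s) = p @ s"
    unfolding filter_empty_conv filter_id_conv using assms by auto
  then show "filter (\<lambda>y. y = v) (p @ v # s) = [v]" "filter (\<lambda>y. y \<noteq> v) (p @ v # s) = p @ s"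
    by simp_all
qed

text \<open>Without the new edge \<open>v\<close> is a component of its own and must be its own
  root, while old vertices are never linked to it.\<close>

lemma meets_once_isolated:
  assumes "v \<notin> \<Union>A" "v \<notin> V"
  shows "meets_once (insert v V) A rs \<longleftrightarrow>
    length (filter (\<lambda>y. y = v) rs) = 1 \<and> meets_once V A (filter (\<lambda>y. y \<noteq> v) rs)"
proof -
  have "filter (linked A v) rs = filter (\<lambda>y. y = v) rs"
  proof -
    have "linked A v = (\<lambda>y. y = v)" using linked_outside(1)[OF assms(1)] by (intro ext)
    then show ?thesis by (simp only:)
  qed
  moreover have "filter (linked A x) rs = filter (linked A x) (filter (\<lambda>y. y \<noteq> v) rs)" if "x \<in> V" for x
  proof -
    have "\<not> linked A x v" using that assms by (auto simp: linked_outside)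
    then show ?thesis unfolding filter_filter by (intro filter_cong refl) auto
  qed
  ultimately show ?thesis by (simp add: meets_once_def)
qed

text \<open>The label \<open>Total\<close> stands for the combination of all vertices \<open>x\<close> with coefficients
  \<open>2 - deg x\<close>; these add up to \<open>2\<close>, and the same combination of
  distances to any vertex is the total length \<open>L\<close>.\<close>

datatype 'a label = Border | Total | Vertex 'a

text \<open>The distance table with a border of ones, as in a Cayley-Menger determinant, extended by
  the values that the combination \<open>Total\<close> takes on a tree of total length
  \<open>L\<close>.\<close>

fun bordered :: "real \<Rightarrow> ('a \<Rightarrow> 'a \<Rightarrow> real) \<Rightarrow> 'a label \<Rightarrow> 'a label \<Rightarrow> real" where
  "bordered L D Border Border = 0"
| "bordered L D Border (Vertex y) = 1"
| "bordered L D (Vertex x) Border = 1"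
| "bordered L D (Vertex x) (Vertex y) = D x y"
| "bordered L D Border Total = 2"
| "bordered L D Total Border = 2"
| "bordered L D Total (Vertex y) = L"
| "bordered L D (Vertex x) Total = L"
| "bordered L D Total Total = 2 * L"

definition bordered_det :: "real \<Rightarrow> ('a \<Rightarrow> 'a \<Rightarrow> real) \<Rightarrow> 'a list \<Rightarrow> 'a list \<Rightarrow> real" where
  "bordered_det L D xs ys =
     det (table (bordered L D) (Border # map Vertex xs) (Border # map Vertex ys))"

lemma bordered_det_not_distinct:
  assumes "length xs = length ys" "\<not> distinct xs \<or> \<not> distinct ys"
  shows "bordered_det L D xs ys = 0"
proof -
  have "distinct (Border # map Vertex xs) \<longleftrightarrow> distinct xs" for xs :: "'a list"
    by (auto simp: distinct_map inj_on_def)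
  then show ?thesis
    unfolding bordered_det_def
    using assms det_table_not_distinct_rows[of "Border # map Vertex xs" "Border # map Vertex ys"]
      det_table_not_distinct_cols[of "Border # map Vertex xs" "Border # map Vertex ys"]
    by (metis length_Cons length_map)
qed

lemma bordered_det_Nil: "bordered_det L D [] [] = 0"
  by (simp add: bordered_det_def det_single table_def)

lemma bordered_det_single: "bordered_det L D [x] [y] = -1"
proof -
  have "det (table (bordered L D) [Border, Vertex x] [Border, Vertex y]) = -1"
    using det_table_sparse_row[of "[]" "[Vertex x]" "[Border]" "[]" "bordered L D" Border "Vertex y"]
    by (simp add: det_single table_def)
  then show ?thesis by (simp add: bordered_det_def)
qed

section \<open>Bordered determinants after attaching a leaf\<close>

context
  fixes V :: "'a set" and E and v q :: 'a and \<alpha> :: "'a set \<Rightarrow> real" and xs ys :: "'a list"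
  assumes tree: "grown_tree V E" and v: "v \<notin> V" and q: "q \<in> V"
    and xs: "set xs \<subseteq> insert v V" and ys: "set ys \<subseteq> insert v V"
    and len: "length xs = length ys"
begin

text \<open>The border absorbs the terms of the new distances that depend on one end only.\<close>

lemma bordered_det_insert_leaf_aux:
  defines "D \<equiv> tree_dist E \<alpha>" and "D' \<equiv> tree_dist (insert {v, q} E) \<alpha>" and "\<pi> \<equiv> fold_leaf v q"
  shows "bordered_det L D' xs ys =
    det (table (\<lambda>x y. bordered L D (map_label \<pi> x) (map_label \<pi> y) -
        2 * \<alpha> {v, q} * of_bool (x = Vertex v \<and> y = Vertex v))
      (Border # map Vertex xs) (Border # map Vertex ys))"
proof -
  let ?a = "\<alpha> {v, q}" and ?xs = "Border # map Vertex xs" and ?ys = "Border # map Vertex ys"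
  define h where "h x y = bordered L D (map_label \<pi> x) (map_label \<pi> y) -
      2 * ?a * of_bool (x = Vertex v \<and> y = Vertex v)" for x y
  \<comment> \<open>The border row times the leaf length is added to row \<open>v\<close>, then the
    same is done with columns. The corner entry 0 prevents a cross term.\<close>
  define c where "c x = ?a * of_bool (x = Vertex v)" for x
  define h1 where "h1 x y = h x y + (if x = Border then 0 else c x * h Border y)" for x y
  define h2 where "h2 x y = h1 x y + (if y = Border then 0 else c y * h1 x Border)" for x y
  have "bordered L D' x y = h2 x y" if "x \<in> set ?xs" "y \<in> set ?ys" for x y
  proof -
    have "x = Border \<or> (\<exists>x'\<in>insert v V. x = Vertex x')" "y = Border \<or> (\<exists>y'\<in>insert v V. y = Vertex y')"
      using that xs ys by auto
    moreover have "D' x' y' = D (\<pi> x') (\<pi> y') + ?a * of_bool (x' = v) + ?a * of_bool (y' = v)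
        - 2 * ?a * of_bool (x' = v \<and> y' = v)" if "x' \<in> insert v V" "y' \<in> insert v V" for x' y'
      unfolding D_def D'_def \<pi>_def by (rule tree_dist_insert_leaf[OF tree v q that])
    ultimately show ?thesis
      by (elim disjE bexE) (simp_all add: h2_def h1_def h_def c_def)
  qed
  then have "bordered_det L D' xs ys = det (table h2 ?xs ?ys)"
    unfolding bordered_det_def by (metis table_cong)
  also have "\<dots> = det (table h1 ?xs ?ys)"
    by (rule det_table_add_head_col) (use len in \<open>auto simp: h2_def\<close>)
  also have "\<dots> = det (table h ?xs ?ys)"
    by (rule det_table_add_head_row) (use len in \<open>auto simp: h1_def\<close>)
  finally show ?thesis unfolding h_def .
qed

text \<open>What the border does not absorb sits at the entry \<open>(v, v)\<close>, which this
  table does not contain.\<close>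

lemma bordered_det_insert_leaf_absent:
  assumes "v \<notin> set xs \<or> v \<notin> set ys"
  shows "bordered_det L (tree_dist (insert {v, q} E) \<alpha>) xs ys =
    bordered_det L (tree_dist E \<alpha>) (map (fold_leaf v q) xs) (map (fold_leaf v q) ys)"
proof -
  let ?xs = "Border # map Vertex xs" and ?ys = "Border # map Vertex ys" and ?\<pi> = "map_label (fold_leaf v q)"
  let ?D = "tree_dist E \<alpha>"
  have "bordered_det L (tree_dist (insert {v, q} E) \<alpha>) xs ys =
      det (table (\<lambda>x y. bordered L ?D (?\<pi> x) (?\<pi> y)) ?xs ?ys)"
    unfolding bordered_det_insert_leaf_aux
    by (rule arg_cong[of _ _ det], rule table_cong) (use assms in auto)
  also have "\<dots> = det (table (bordered L ?D) (map ?\<pi> ?xs) (map ?\<pi> ?ys))"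
    by (simp only: table_map)
  also have "map ?\<pi> ?xs = Border # map Vertex (map (fold_leaf v q) xs)" by simp
  also have "map ?\<pi> ?ys = Border # map Vertex (map (fold_leaf v q) ys)" by simp
  finally show ?thesis unfolding bordered_det_def .
qed

text \<open>Here the corrected entry occurs once, on the diagonal, and contributes
  \<open>- 2 * \<alpha> {v, q}\<close> times the minor without \<open>v\<close>, on which the
  contraction acts trivially.\<close>

lemma bordered_det_insert_leaf_present:
  assumes "xs = xs1 @ v # xs2" "ys = ys1 @ v # ys2" "length xs1 = length ys1"
    and "distinct xs" "distinct ys"
  shows "bordered_det L (tree_dist (insert {v, q} E) \<alpha>) xs ys =
    bordered_det L (tree_dist E \<alpha>) (map (fold_leaf v q) xs) (map (fold_leaf v q) ys)
    - 2 * \<alpha> {v, q} * bordered_det L (tree_dist E \<alpha>) (xs1 @ xs2) (ys1 @ ys2)"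
proof -
  let ?V = "map Vertex" and ?\<pi> = "map_label (fold_leaf v q)"
  let ?xs = "(Border # ?V xs1) @ Vertex v # ?V xs2" and ?ys = "(Border # ?V ys1) @ Vertex v # ?V ys2"
  let ?D = "tree_dist E \<alpha>"
  let ?h = "\<lambda>x y. bordered L ?D (?\<pi> x) (?\<pi> y)"
  let ?h' = "\<lambda>x y. ?h x y - 2 * \<alpha> {v, q} * of_bool (x = Vertex v \<and> y = Vertex v)"
  have "bordered_det L (tree_dist (insert {v, q} E) \<alpha>) xs ys = det (table ?h' ?xs ?ys)"
    unfolding bordered_det_insert_leaf_aux by (simp add: assms(1,2))
  also have "\<dots> = det (table ?h ?xs ?ys) + (?h' (Vertex v) (Vertex v) - ?h (Vertex v) (Vertex v)) *
      det (table ?h ((Border # ?V xs1) @ ?V xs2) ((Border # ?V ys1) @ ?V ys2))"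
    by (rule det_table_change_entry) (use assms len in auto)
  also have "table ?h ?xs ?ys = table (bordered L ?D) (map ?\<pi> ?xs) (map ?\<pi> ?ys)"
    by (simp only: table_map)
  also have "map ?\<pi> ?xs = Border # ?V (map (fold_leaf v q) xs)" by (simp add: assms(1))
  also have "map ?\<pi> ?ys = Border # ?V (map (fold_leaf v q) ys)" by (simp add: assms(2))
  also have "table ?h ((Border # ?V xs1) @ ?V xs2) ((Border # ?V ys1) @ ?V ys2) =
      table (bordered L ?D) (Border # ?V (xs1 @ xs2)) (Border # ?V (ys1 @ ys2))"
    unfolding append_Cons map_append[symmetric]
    by (rule table_cong) (use assms in auto)
  also have "?h' (Vertex v) (Vertex v) - ?h (Vertex v) (Vertex v) = - (2 * \<alpha> {v, q})" by simp
  finally show ?thesis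
    unfolding bordered_det_def by (simp only: mult_minus_left diff_conv_add_uminus)
qed

end

text \<open>The first root plays the part of \<open>u = w\<close>, where being linked is automatic.
  With no roots both sides are 0, so the truncated exponent does no harm. The diagonal case is a
  hypothesis so that the following induction can already apply this.\<close>

lemma bordered_det_rooted_forests_aux:
  assumes "V \<noteq> {}" "set ss \<subseteq> V"
    and "\<And>u ss. u \<in> V \<Longrightarrow> set ss \<subseteq> V \<Longrightarrow> bordered_det L D (u # ss) (u # ss) =
      - ((-2) ^ length ss) * coweight_sum E \<alpha> (\<lambda>A. meets_once V A (u # ss) \<and> linked A u u)"
  shows "bordered_det L D ss ss =
    - ((-2) ^ (length ss - 1)) * coweight_sum E \<alpha> (\<lambda>A. meets_once V A ss)"
proof (cases ss)
  case Nil
  have "\<not> meets_once V A []" for A using assms(1) by (auto simp: meets_once_def)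
  then show ?thesis by (simp add: Nil bordered_det_Nil coweight_sum_False)
next
  case (Cons s ss')
  then show ?thesis using assms(2) assms(3)[of s ss'] by simp
qed

text \<open>Attaching a leaf \<open>v\<close> to \<open>q\<close>, forests that use the new edge correspond to forests of the old
  tree with \<open>q\<close> in place of \<open>v\<close>; in the other forests \<open>v\<close> is a component of its own. The
  determinants satisfy the same recursion.\<close>

lemma bordered_det_forests:
  assumes "grown_tree V E" "u \<in> V" "w \<in> V" "set ss \<subseteq> V"
  shows "bordered_det L (tree_dist E \<alpha>) (w # ss) (u # ss) =
    - ((-2) ^ length ss) * coweight_sum E \<alpha> (\<lambda>A. meets_once V A (u # ss) \<and> linked A u w)"
  using assms
proof (induction arbitrary: u w ss rule: grown_tree.induct)
  case (single r)
  have uw: "u = r" "w = r" using single by auto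
  show ?case
  proof (cases ss)
    case Nil
    have "coweight_sum {} \<alpha> (\<lambda>A. meets_once {r} A [r] \<and> linked A r r) = 1"
      by (simp add: coweight_sum_def coweight_def meets_once_def)
    then show ?thesis by (simp add: Nil uw bordered_det_single)
  next
    case (Cons s ss')
    then have "s = r" using single by auto
    have "coweight_sum {} \<alpha> (\<lambda>A. meets_once {r} A (r # ss) \<and> linked A r r) = 0"
      by (rule coweight_sum_False) (auto simp: Cons \<open>s = r\<close> meets_once_def)
    then show ?thesis
      using bordered_det_not_distinct[of "w # ss" "u # ss"] by (simp add: uw Cons \<open>s = r\<close>)
  qed
next
  case (leaf V E v q)
  note tree = leaf.hyps(1) and v = leaf.hyps(2) and q = leaf.hyps(3)
  let ?E = "insert {v, q} E" and ?V = "insert v V" and ?\<pi> = "fold_leaf v q" and ?a = "\<alpha> {v, q}"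
  let ?D = "tree_dist E \<alpha>" and ?D' = "tree_dist (insert {v, q} E) \<alpha>"
  let ?n = "length ss"
  have fin: "finite E" and E: "\<And>e. e \<in> E \<Longrightarrow> e \<subseteq> V"
    using grown_tree_finite[OF tree] grown_tree_edge_subset[OF tree] by auto
  have vE: "v \<notin> \<Union>A" if "A \<subseteq> E" for A using that E v by blast
  have "v \<noteq> q" "{v, q} \<notin> E" using E v q by auto
  have sub: "set (w # ss) \<subseteq> ?V" "set (u # ss) \<subseteq> ?V" using leaf.prems by auto
  show ?case
  proof (cases "distinct (u # ss) \<and> distinct (w # ss)")
    \<comment> \<open>Both sides vanish: the table has equal rows or columns, and every edge set
      fails because a repeated root counts twice or \<open>w\<close> is a second root linked to
      \<open>u\<close>.\<close>
    case False
    then have "coweight_sum ?E \<alpha> (\<lambda>A. meets_once ?V A (u # ss) \<and> linked A u w) = 0"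
      using leaf.prems meets_once_distinct[of ?V _ "u # ss"] meets_once_head[of ?V _ u ss w]
      by (intro coweight_sum_False) auto
    then show ?thesis
      using False bordered_det_not_distinct[of "w # ss" "u # ss"] by auto
  next
    case True
    \<comment> \<open>Collects the edge sets avoiding the new edge, before the factor
      \<open>\<alpha> {v, q}\<close>.\<close>
    define rest where "rest = coweight_sum E \<alpha> (\<lambda>A. meets_once ?V A (u # ss) \<and> linked A u w)"
    have split: "coweight_sum ?E \<alpha> (\<lambda>A. meets_once ?V A (u # ss) \<and> linked A u w) =
        coweight_sum E \<alpha> (\<lambda>A. meets_once V A (?\<pi> u # map ?\<pi> ss) \<and> linked A (?\<pi> u) (?\<pi> w)) + ?a * rest"
      unfolding rest_def coweight_sum_insert[OF fin \<open>{v, q} \<notin> E\<close>]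
      by (intro arg_cong2[of _ _ _ _ "(+)"] coweight_sum_cong refl)
        (simp only: meets_once_insert_leaf[OF vE v q] linked_insert_leaf[OF vE \<open>v \<noteq> q\<close>] list.map)
    have fold: "bordered_det L ?D (map ?\<pi> (w # ss)) (map ?\<pi> (u # ss)) = - ((-2) ^ ?n) *
        coweight_sum E \<alpha> (\<lambda>A. meets_once V A (?\<pi> u # map ?\<pi> ss) \<and> linked A (?\<pi> u) (?\<pi> w))"
    proof -
      have "?\<pi> u \<in> V" "?\<pi> w \<in> V" "set (map ?\<pi> ss) \<subseteq> V" using leaf.prems q by auto
      from leaf.IH[OF this] show ?thesis by (simp only: list.map length_map)
    qed
    have absent: ?thesis if "v \<notin> set (w # ss) \<or> v \<notin> set (u # ss)" "rest = 0"
      unfolding split fold[symmetric] \<open>rest = 0\<close>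
      using bordered_det_insert_leaf_absent[OF tree v q sub _ that(1)] fold by simp
    show ?thesis
    proof (cases "v \<in> set ss")
      \<comment> \<open>An isolated root \<open>v\<close> can be struck from \<open>ss\<close>. The
        lost power of -2 comes back through the factor \<open>- 2 * \<alpha> {v, q}\<close> in the
        determinant recursion.\<close>
      case True': True
      then obtain p s where ss: "ss = p @ v # s" by (meson split_list)
      have nv: "v \<notin> set (u # w # p @ s)" using True ss by auto
      have "rest = coweight_sum E \<alpha> (\<lambda>A. meets_once V A (u # p @ s) \<and> linked A u w)"
        unfolding rest_def
      proof (rule coweight_sum_cong)
        fix A assume "A \<subseteq> E"
        have "filter (\<lambda>y. y = v) (u # ss) = [v]" "filter (\<lambda>y. y \<noteq> v) (u # ss) = u # p @ s"
          using filter_split_off[of v "u # p" s] nv by (simp_all add: ss)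
        then show "meets_once ?V A (u # ss) \<and> linked A u w \<longleftrightarrow> meets_once V A (u # p @ s) \<and> linked A u w"
          unfolding meets_once_isolated[OF vE[OF \<open>A \<subseteq> E\<close>] v] by simp
      qed
      moreover have "bordered_det L ?D (w # p @ s) (u # p @ s) = - ((-2) ^ (?n - 1)) *
          coweight_sum E \<alpha> (\<lambda>A. meets_once V A (u # p @ s) \<and> linked A u w)"
        using leaf.IH[of u w "p @ s"] leaf.prems nv ss by auto
      ultimately have "bordered_det L ?D (w # p @ s) (u # p @ s) = - ((-2) ^ (?n - 1)) * rest"
        by simp
      moreover have "bordered_det L ?D' (w # ss) (u # ss) =
          bordered_det L ?D (map ?\<pi> (w # ss)) (map ?\<pi> (u # ss)) -
          2 * ?a * bordered_det L ?D (w # p @ s) (u # p @ s)"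
        using bordered_det_insert_leaf_present[OF tree v q sub, of "w # p" s "u # p" s L \<alpha>] True ss
        by simp
      moreover have "(-2) ^ ?n = -2 * (-2) ^ (?n - 1 :: nat) * (1 :: real)" by (simp add: ss)
      ultimately show ?thesis unfolding split fold by (simp add: algebra_simps)
    next
      case False
      consider "u = v" "w = v" | "u \<noteq> v" | "u = v" "w \<noteq> v" by blast
      then show ?thesis
      proof cases
        case 1
        \<comment> \<open>The floating component is now the isolated \<open>v\<close> itself;
          removing it leaves the forests rooted at \<open>ss\<close>.\<close>
        have "rest = coweight_sum E \<alpha> (\<lambda>A. meets_once V A ss)"
          unfolding rest_def
        proof (rule coweight_sum_cong)
          fix A assume "A \<subseteq> E"
          have "filter (\<lambda>y. y = v) (u # ss) = [v]" "filter (\<lambda>y. y \<noteq> v) (u # ss) = ss"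
            using filter_split_off[of v "[]" ss] 1 False by simp_all
          then show "meets_once ?V A (u # ss) \<and> linked A u w \<longleftrightarrow> meets_once V A ss"
            unfolding meets_once_isolated[OF vE[OF \<open>A \<subseteq> E\<close>] v] by (simp add: 1)
        qed
        moreover have "bordered_det L ?D ss ss =
            - ((-2) ^ (?n - 1)) * coweight_sum E \<alpha> (\<lambda>A. meets_once V A ss)"
          by (rule bordered_det_rooted_forests_aux) (use q leaf.prems False leaf.IH in auto)
        ultimately have det_rest: "bordered_det L ?D ss ss = - ((-2) ^ (?n - 1)) * rest" by simp
        have "bordered_det L ?D' (w # ss) (u # ss) =
            bordered_det L ?D (map ?\<pi> (w # ss)) (map ?\<pi> (u # ss)) - 2 * ?a * bordered_det L ?D ss ss"
          using bordered_det_insert_leaf_present[OF tree v q sub, of "[]" ss "[]" ss L \<alpha>] True 1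
          by simp
        \<comment> \<open>For empty \<open>ss\<close> the truncated exponent breaks the identity of
          powers, but then \<open>det_rest\<close> forces \<open>rest = 0\<close>.\<close>
        moreover have "?a * ((-2) ^ ?n * rest) = ?a * (-2 * (-2) ^ (?n - 1) * rest)"
        proof (cases ss)
          case Nil
          then show ?thesis using det_rest by (simp add: bordered_det_Nil)
        qed simp
        ultimately show ?thesis unfolding split fold det_rest by (simp add: algebra_simps)
      next
        case 2
        \<comment> \<open>An isolated \<open>v\<close> needs itself as a root, and it is not in the
          list.\<close>
        have "filter (\<lambda>y. y = v) (u # ss) = []"
          unfolding filter_empty_conv using 2 False by auto
        then have "rest = 0"
          unfolding rest_def by (intro coweight_sum_False) (simp add: meets_once_isolated[OF vE v])
        then show ?thesis using absent 2 False by auto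
      next
        case 3
        have "rest = 0"
          unfolding rest_def
          by (rule coweight_sum_False) (use 3 in \<open>auto simp: linked_outside[OF vE]\<close>)
        then show ?thesis using absent 3 False by auto
      qed
    qed
  qed
qed

lemma bordered_det_rooted_forests:
  assumes "grown_tree V E" "set ss \<subseteq> V"
  shows "bordered_det L (tree_dist E \<alpha>) ss ss =
    - ((-2) ^ (length ss - 1)) * coweight_sum E \<alpha> (\<lambda>A. meets_once V A ss)"
proof (rule bordered_det_rooted_forests_aux)
  show "V \<noteq> {}" using assms(1) by (cases rule: grown_tree.cases) auto
qed (use assms(2) bordered_det_forests[OF assms(1)] in blast)+

section \<open>Vertex weights of total mass two\<close>

definition tau :: "'a set set \<Rightarrow> 'a \<Rightarrow> real" where
  "tau E x = 2 - real (card {e \<in> E. x \<in> e})"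

definition component :: "'a set \<Rightarrow> 'a set set \<Rightarrow> 'a \<Rightarrow> 'a set" where
  "component V A u = {x \<in> V. linked A u x}"

definition outdeg :: "'a set set \<Rightarrow> 'a set \<Rightarrow> nat" where
  "outdeg E C = card {e \<in> E. card (e \<inter> C) = 1}"

section \<open>Vertex weights, outdegrees and components after attaching a leaf\<close>

context
  fixes V :: "'a set" and E and v q :: 'a
  assumes tree: "grown_tree V E" and v: "v \<notin> V" and q: "q \<in> V"
begin

lemma leaf_facts:
  shows "finite V" "finite E" "\<And>e. e \<in> E \<Longrightarrow> e \<subseteq> V" "v \<notin> \<Union>E" "{v, q} \<notin> E" "v \<noteq> q"
  using grown_tree_finite[OF tree] grown_tree_edge_subset[OF tree] v q by auto

lemma tau_insert_leaf_new: "tau (insert {v, q} E) v = 1"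
proof -
  have "{e \<in> insert {v, q} E. v \<in> e} = {{v, q}}" using leaf_facts by auto
  then show ?thesis by (simp add: tau_def)
qed

lemma tau_insert_leaf_old:
  assumes "x \<in> V"
  shows "tau (insert {v, q} E) x = tau E x - of_bool (x = q)"
proof (cases "x = q")
  case True
  have "{e \<in> insert {v, q} E. q \<in> e} = insert {v, q} {e \<in> E. q \<in> e}" by auto
  then show ?thesis using leaf_facts True by (simp add: tau_def)
next
  case False
  then have "{e \<in> insert {v, q} E. x \<in> e} = {e \<in> E. x \<in> e}" using assms v by auto
  then show ?thesis using False by (simp add: tau_def)
qed

lemma sum_tau_insert_leaf_old:
  assumes "C \<subseteq> V"
  shows "(\<Sum>x\<in>C. tau (insert {v, q} E) x * f x) = (\<Sum>x\<in>C. tau E x * f x) - of_bool (q \<in> C) * f q"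
proof -
  have "finite C" using assms leaf_facts(1) finite_subset by blast
  have "(\<Sum>x\<in>C. tau (insert {v, q} E) x * f x) = (\<Sum>x\<in>C. tau E x * f x - (if x = q then f x else 0))"
    using assms by (intro sum.cong refl) (auto simp: tau_insert_leaf_old algebra_simps)
  also have "\<dots> = (\<Sum>x\<in>C. tau E x * f x) - of_bool (q \<in> C) * f q"
    using \<open>finite C\<close> by (simp add: sum_subtractf)
  finally show ?thesis .
qed

lemma outdeg_insert_leaf:
  assumes "C \<subseteq> insert v V"
  shows "outdeg (insert {v, q} E) C = outdeg E (C - {v}) + of_bool (v \<in> C \<longleftrightarrow> q \<notin> C)"
proof -
  let ?cut = "\<lambda>E C. {e \<in> E. card (e \<inter> C) = 1}"
  have "e \<inter> C = e \<inter> (C - {v})" if "e \<in> E" for e using leaf_facts(4) that by auto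
  then have old: "?cut E C = ?cut E (C - {v})" by auto
  have "card ({v, q} \<inter> C) = 1 \<longleftrightarrow> (v \<in> C \<longleftrightarrow> q \<notin> C)"
    using leaf_facts(6) by (cases "v \<in> C"; cases "q \<in> C") (auto simp: Int_insert_left)
  then have "?cut (insert {v, q} E) C =
      (if v \<in> C \<longleftrightarrow> q \<notin> C then insert {v, q} (?cut E C) else ?cut E C)" by auto
  then show ?thesis using leaf_facts(2,5) old by (simp add: outdeg_def)
qed

text \<open>The leaf has weight 1, the weight of \<open>q\<close> drops by 1, and the new edge is
  cut when exactly one end lies in \<open>C\<close>. These changes cancel unless \<open>C\<close>
  contains \<open>v\<close> but not \<open>q\<close>.\<close>

lemma sum_tau_outdeg_insert_leaf:
  assumes "C \<subseteq> insert v V"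
  shows "sum (tau (insert {v, q} E)) C + outdeg (insert {v, q} E) C =
    sum (tau E) (C - {v}) + outdeg E (C - {v}) + 2 * of_bool (v \<in> C \<and> q \<notin> C)"
proof -
  have "finite C" using assms leaf_facts(1) finite_subset by blast
  have "sum (tau (insert {v, q} E)) C = sum (tau (insert {v, q} E)) (C - {v}) + of_bool (v \<in> C)"
    using \<open>finite C\<close> by (cases "v \<in> C") (simp_all add: sum.remove[of C v] tau_insert_leaf_new)
  also have "sum (tau (insert {v, q} E)) (C - {v}) = sum (tau E) (C - {v}) - of_bool (q \<in> C)"
  proof -
    have "C - {v} \<subseteq> V" using assms by auto
    from sum_tau_insert_leaf_old[OF this, of "\<lambda>_. 1"] show ?thesis using leaf_facts(6) by simp
  qed
  finally show ?thesis by (simp add: outdeg_insert_leaf[OF assms])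
qed

lemma component_insert_leaf_edge:
  assumes "A \<subseteq> E" "u \<in> insert v V"
  defines "C \<equiv> component (insert v V) (insert {v, q} A) u"
  shows "C - {v} = component V A (fold_leaf v q u)" "v \<in> C \<longleftrightarrow> q \<in> C" 
proof -
  have "v \<notin> \<Union>A" using assms(1) leaf_facts(4) by auto
  then show "C - {v} = component V A (fold_leaf v q u)" "v \<in> C \<longleftrightarrow> q \<in> C"
    using v q unfolding C_def component_def by (auto simp: linked_insert_leaf[OF _ leaf_facts(6)])
qed

lemma component_insert_leaf_isolated:
  assumes "A \<subseteq> E"
  shows "component (insert v V) A v = {v}" "u \<in> V \<Longrightarrow> component (insert v V) A u = component V A u"
proof -
  have "v \<notin> \<Union>A" using assms(1) leaf_facts(4) by auto
  then show "component (insert v V) A v = {v}" "u \<in> V \<Longrightarrow> component (insert v V) A u = component V A u"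
    using v unfolding component_def by (auto simp: linked_outside)
qed

end

text \<open>A component \<open>C\<close> spans \<open>card C - 1\<close> tree edges, so its degrees
  add up to twice that number plus the outdegree. The induction avoids this count: a leaf leaves the
  sum unchanged, and a new component \<open>{v}\<close> starts at 2.\<close>

lemma sum_tau_component:
  "grown_tree V E \<Longrightarrow> A \<subseteq> E \<Longrightarrow> u \<in> V \<Longrightarrow>
    sum (tau E) (component V A u) + outdeg E (component V A u) = 2"
proof (induction arbitrary: A u rule: grown_tree.induct)
  case (single r)
  then have "component {r} A u = {r}" by (auto simp: component_def)
  then show ?case by (simp add: tau_def outdeg_def)
next
  case (leaf V E v q)
  note step = sum_tau_outdeg_insert_leaf[OF leaf.hyps]
    and edge = component_insert_leaf_edge[OF leaf.hyps]
    and isolated = component_insert_leaf_isolated[OF leaf.hyps]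
  let ?C = "component (insert v V) A u"
  have C: "?C \<subseteq> insert v V" by (auto simp: component_def)
  show ?case
  proof (cases "{v, q} \<in> A")
    case True
    define A' where "A' = A - {{v, q}}"
    then have A': "A = insert {v, q} A'" "A' \<subseteq> E" using True leaf.prems by auto
    have "fold_leaf v q u \<in> V" using leaf.prems leaf.hyps by auto
    then show ?thesis
      unfolding step[OF C] using edge[OF A'(2) leaf.prems(2)] leaf.IH[OF A'(2)] by (simp add: A'(1))
  next
    case False
    then have A: "A \<subseteq> E" using leaf.prems by auto
    show ?thesis
    proof (cases "u = v")
      case True
      have "v \<noteq> q" using leaf.hyps by auto
      then show ?thesis
        using step[OF C] unfolding True isolated(1)[OF A] by (simp add: outdeg_def)
    next
      case False
      then have "u \<in> V" using leaf.prems by auto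
      moreover have "v \<notin> component V A u" using leaf.hyps by (auto simp: component_def)
      ultimately show ?thesis
        using step[OF C] leaf.IH[OF A \<open>u \<in> V\<close>] unfolding isolated(2)[OF A \<open>u \<in> V\<close>] by simp
    qed
  qed
qed

lemma sum_tau:
  assumes "grown_tree V E"
  shows "sum (tau E) V = 2"
proof -
  obtain u where u: "u \<in> V" using assms by (cases rule: grown_tree.cases) auto
  have V: "component V E u = V"
    using grown_tree_linked[OF assms u] by (auto simp: component_def)
  have "e \<inter> V = e" if "e \<in> E" for e using grown_tree_edge_subset[OF assms that] by auto
  moreover have "card e = 2" if "e \<in> E" for e
    using assms that by (induction rule: grown_tree.induct) (auto simp: card_insert_if)
  ultimately have "{e \<in> E. card (e \<inter> V) = 1} = {}" by auto
  then have "outdeg E V = 0" by (simp only: outdeg_def card.empty)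
  then show ?thesis using sum_tau_component[OF assms order.refl u] by (simp add: V)
qed

text \<open>For old \<open>y\<close>, the distance from \<open>v\<close> exceeds the term lost at
  \<open>q\<close> by exactly the new edge. For \<open>y = v\<close>, all old distances to
  \<open>q\<close> grow by the new edge: total weight 2 contributes it twice, and the reduced weight
  of \<open>q\<close> takes it away once.\<close>

lemma sum_tau_dist:
  "grown_tree V E \<Longrightarrow> y \<in> V \<Longrightarrow> (\<Sum>x\<in>V. tau E x * tree_dist E \<alpha> x y) = sum \<alpha> E"
proof (induction arbitrary: y rule: grown_tree.induct)
  case (single r)
  then show ?case by (simp add: tree_dist_same)
next
  case (leaf V E v q)
  note tree = leaf.hyps(1) and facts = leaf_facts[OF leaf.hyps]
    and old = sum_tau_insert_leaf_old[OF leaf.hyps order.refl]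
  let ?E = "insert {v, q} E" and ?a = "\<alpha> {v, q}"
  note dist = tree_dist_insert_leaf[OF leaf.hyps, of _ _ \<alpha>]
  have split: "(\<Sum>x\<in>insert v V. tau ?E x * tree_dist ?E \<alpha> x y) =
      tree_dist ?E \<alpha> v y + (\<Sum>x\<in>V. tau ?E x * tree_dist ?E \<alpha> x y)"
    using facts leaf.hyps(2) by (simp add: tau_insert_leaf_new[OF leaf.hyps])
  have sum_E: "sum \<alpha> ?E = ?a + sum \<alpha> E" using facts by simp
  show ?case
  proof (cases "y = v")
    case True
    have "(\<Sum>x\<in>V. tau ?E x * tree_dist ?E \<alpha> x v) = (\<Sum>x\<in>V. tau ?E x * (tree_dist E \<alpha> x q + ?a))"
      using leaf.hyps(2) by (intro sum.cong refl) (auto simp: dist)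
    also have "\<dots> = (\<Sum>x\<in>V. tau E x * (tree_dist E \<alpha> x q + ?a)) - (tree_dist E \<alpha> q q + ?a)"
      using old leaf.hyps(3) by simp
    also have "\<dots> = (\<Sum>x\<in>V. tau E x * tree_dist E \<alpha> x q) + sum (tau E) V * ?a - ?a"
      by (simp add: tree_dist_same distrib_left sum.distrib sum_distrib_right)
    also have "\<dots> = sum \<alpha> E + ?a" using leaf.IH[OF leaf.hyps(3)] sum_tau[OF tree] by simp
    finally show ?thesis unfolding split sum_E by (simp add: True tree_dist_same)
  next
    case False
    then have y: "y \<in> V" using leaf.prems by simp
    have "(\<Sum>x\<in>V. tau ?E x * tree_dist ?E \<alpha> x y) = (\<Sum>x\<in>V. tau ?E x * tree_dist E \<alpha> x y)"
      using leaf.hyps(2) y False by (intro sum.cong refl) (auto simp: dist)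
    also have "\<dots> = sum \<alpha> E - tree_dist E \<alpha> q y"
      using old leaf.hyps(3) leaf.IH[OF y] by simp
    finally show ?thesis unfolding split sum_E using y False by (simp add: dist)
  qed
qed

section \<open>Summing the bordered determinants over the vertices\<close>

text \<open>Subtracting \<open>L\<close> times the border from the row and column
  \<open>Total\<close> leaves 2 against the border, \<open>- 2 * L\<close> in the corner and 0
  elsewhere. The corner yields the bordered determinant; the two entries 2 yield the plain
  one.\<close>

lemma det_total_labels:
  "det (table (bordered L D) (Border # Total # map Vertex ss) (Border # Total # map Vertex ss)) =
    - 2 * L * bordered_det L D ss ss - 4 * det (principal_submatrix D ss)"
proof -
  let ?V = "map Vertex ss" and ?f = "bordered L D"
  define c where "c x = - L * of_bool (x = Total)" for x :: "'a label"
  define h1 where "h1 x y = ?f x y + (if x = Border then 0 else c x * ?f Border y)" for x y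
  define h2 where "h2 x y = h1 x y + (if y = Border then 0 else c y * h1 x Border)" for x y
  \<comment> \<open>Clears the corner, so that row and column \<open>Total\<close> keep one nonzero
    entry each.\<close>
  define h3 where "h3 x y = (if x = Total \<and> y = Total then 0 else h2 x y)" for x y
  have h3_old: "h3 x y = ?f x y" if "x \<noteq> Total" "y \<noteq> Total" for x y
    using that by (simp add: h3_def h2_def h1_def c_def)
  have h2_Total: "h2 Total Total = - 2 * L"
    by (simp add: h2_def h1_def c_def)
  have h3_Total: "h3 Total (Vertex x) = 0" "h3 (Vertex x) Total = 0" "h3 Total Total = 0"
    "h3 Total Border = 2" "h3 Border Total = 2" for x
    by (simp_all add: h3_def h2_def h1_def c_def)
  have "det (table ?f (Border # Total # ?V) (Border # Total # ?V)) =
      det (table h1 (Border # Total # ?V) (Border # Total # ?V))"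
    by (rule det_table_add_head_row[symmetric]) (auto simp: h1_def)
  also have "\<dots> = det (table h2 (Border # Total # ?V) (Border # Total # ?V))"
    by (rule det_table_add_head_col[symmetric]) (auto simp: h2_def)
  also have "\<dots> = det (table h2 ([Border] @ Total # ?V) ([Border] @ Total # ?V))" by simp
  also have "\<dots> = det (table h3 ([Border] @ Total # ?V) ([Border] @ Total # ?V)) +
      (h2 Total Total - h3 Total Total) * det (table h3 ([Border] @ ?V) ([Border] @ ?V))"
    by (rule det_table_change_entry) (auto simp: h3_def)
  also have "table h3 ([Border] @ ?V) ([Border] @ ?V) = table ?f (Border # ?V) (Border # ?V)"
    unfolding append_Cons append_Nil by (rule table_cong) (auto intro!: h3_old)
  \<comment> \<open>The lists are regrouped so that row \<open>Total\<close> is expanded at column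
    \<open>Border\<close>, with sign -1, and then column \<open>Total\<close> at row
    \<open>Border\<close>, with sign +1. Together this gives the factor -4.\<close>
  also have "det (table h3 ([Border] @ Total # ?V) ([Border] @ Total # ?V)) =
      det (table h3 ([Border] @ Total # ?V) ([] @ Border # Total # ?V))" by simp
  also have "\<dots> = (-1) ^ (length [Border :: 'a label] + length ([] :: 'a label list)) * h3 Total Border *
      det (table h3 ([Border] @ ?V) ([] @ Total # ?V))"
    by (rule det_table_sparse_row) (auto simp: h3_Total)
  also have "det (table h3 ([Border] @ ?V) ([] @ Total # ?V)) =
      det (table h3 ([] @ Border # ?V) ([] @ Total # ?V))" by simp
  also have "\<dots> = (-1) ^ (length ([] :: 'a label list) + length ([] :: 'a label list)) * h3 Border Total *
      det (table h3 ([] @ ?V) ([] @ ?V))"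
    by (rule det_table_sparse_col) (auto simp: h3_Total)
  also have "table h3 ([] @ ?V) ([] @ ?V) = table ?f ?V ?V"
    unfolding append_Nil by (rule table_cong) (auto intro!: h3_old)
  also have "table ?f ?V ?V = principal_submatrix D ss"
    unfolding table_map by (simp add: table_def principal_submatrix_def)
  finally show ?thesis by (simp add: h3_Total h2_Total bordered_det_def)
qed

text \<open>Linearity in the second column and then in the second row collapses the double sum to
  the table with \<open>Total\<close> in both places. The entries of \<open>Total\<close> are the
  weighted sums of vertex entries by \<open>sum_tau\<close> and \<open>sum_tau_dist\<close>.\<close>

lemma sum_tau_bordered_det:
  fixes \<alpha> :: "'a set \<Rightarrow> real"
  assumes tree: "grown_tree V E" and ss: "set ss \<subseteq> V"
  defines "D \<equiv> tree_dist E \<alpha>" and "L \<equiv> sum \<alpha> E"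
  shows "(\<Sum>u\<in>V. \<Sum>w\<in>V. tau E u * tau E w * bordered_det L D (w # ss) (u # ss)) =
    - 2 * L * bordered_det L D ss ss - 4 * det (principal_submatrix D ss)"
proof -
  let ?f = "bordered L D" and ?V = "map Vertex ss"
  have L: "(\<Sum>x\<in>V. tau E x * D x y) = L" "(\<Sum>x\<in>V. tau E x * D y x) = L" if "y \<in> V" for y
  proof -
    show *: "(\<Sum>x\<in>V. tau E x * D x y) = L"
      unfolding D_def L_def by (rule sum_tau_dist[OF tree that])
    have "D y x = D x y" if "x \<in> V" for x
      unfolding D_def by (rule tree_dist_sym[OF grown_tree_unique_path[OF tree that \<open>y \<in> V\<close>]])
    then have "(\<Sum>x\<in>V. tau E x * D y x) = (\<Sum>x\<in>V. tau E x * D x y)"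
      by (intro sum.cong refl) simp
    then show "(\<Sum>x\<in>V. tau E x * D y x) = L" using * by simp
  qed
  have Ltau: "(\<Sum>x\<in>V. tau E x * L) = 2 * L"
    using sum_tau[OF tree] by (simp add: sum_distrib_right[symmetric])
  have row: "?f Total y = (\<Sum>x\<in>V. tau E x * ?f (Vertex x) y)"
    if "y \<in> {Border, Total} \<union> Vertex ` V" for y
    using that sum_tau[OF tree] by (auto simp: L Ltau)
  have col: "?f x Total = (\<Sum>y\<in>V. tau E y * ?f x (Vertex y))"
    if "x \<in> {Border, Total} \<union> Vertex ` V" for x
    using that sum_tau[OF tree] by (auto simp: L Ltau)
  let ?T = "\<lambda>x y. det (table ?f (Border # x # ?V) (Border # y # ?V))"
  have "?T Total Total = (\<Sum>u\<in>V. tau E u * ?T Total (Vertex u))"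
  proof -
    have "?f x Total = (\<Sum>y\<in>V. tau E y * ?f x (Vertex y))" if "x \<in> set (Border # Total # ?V)" for x
      by (rule col) (use that ss in auto)
    from det_table_col_sum[where f = ?f, of "Border # Total # ?V" "Border # Total # ?V" 1, OF _ _ this] show ?thesis by simp
  qed
  also have "\<dots> = (\<Sum>u\<in>V. tau E u * (\<Sum>w\<in>V. tau E w * ?T (Vertex w) (Vertex u)))"
  proof (intro sum.cong refl)
    fix u assume "u \<in> V"
    have "?f Total y = (\<Sum>x\<in>V. tau E x * ?f (Vertex x) y)" if "y \<in> set (Border # Vertex u # ?V)" for y
      by (rule row) (use that \<open>u \<in> V\<close> ss in auto)
    from det_table_row_sum[where f = ?f, of "Border # Total # ?V" "Border # Vertex u # ?V" 1, OF _ _ this]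
    show "tau E u * ?T Total (Vertex u) = tau E u * (\<Sum>w\<in>V. tau E w * ?T (Vertex w) (Vertex u))"
      by simp
  qed
  finally show ?thesis
    unfolding det_total_labels
    by (simp add: bordered_det_def sum_distrib_left mult.assoc)
qed

section \<open>Rooted forests and their floating components\<close>

lemma acyclic_graph_subset: "acyclic_graph E \<Longrightarrow> A \<subseteq> E \<Longrightarrow> acyclic_graph A"
proof -
  assume "A \<subseteq> E"
  then have "is_cycle E c" if "is_cycle A c" for c
    using that successively_mono[of "\<lambda>x y. {x, y} \<in> A" c "\<lambda>x y. {x, y} \<in> E"]
    by (auto simp: is_cycle_def)
  then show "acyclic_graph E \<Longrightarrow> acyclic_graph A" unfolding acyclic_graph_def by blast
qed

section \<open>Components as classes of linked vertices\<close>

lemma graph_components_eq: "graph_components V A = component V A ` V"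
  by (simp add: graph_components_def component_def linked_def)

lemma component_self: "u \<in> V \<Longrightarrow> u \<in> component V A u"
  by (simp add: component_def)

lemma component_eq_iff:
  assumes "u \<in> V" "x \<in> V"
  shows "component V A x = component V A u \<longleftrightarrow> linked A x u"
proof
  assume "component V A x = component V A u"
  then have "x \<in> component V A u" using component_self[OF assms(2), of A] by simp
  then show "linked A x u" by (simp add: component_def linked_sym)
next
  assume xu: "linked A x u"
  have "linked A x y \<longleftrightarrow> linked A u y" for y
    using xu linked_trans linked_sym by metis
  then show "component V A x = component V A u" by (simp add: component_def)
qed

lemma graph_components_disjoint:
  assumes "C \<in> graph_components V A" "C' \<in> graph_components V A" "C \<noteq> C'"
  shows "C \<inter> C' = {}"
proof (rule ccontr)
  assume "C \<inter> C' \<noteq> {}"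
  then obtain y where y: "y \<in> C" "y \<in> C'" by blast
  obtain x x' where x: "x \<in> V" "x' \<in> V" "C = component V A x" "C' = component V A x'"
    using assms unfolding graph_components_eq by blast
  then have "linked A x x'" using y by (auto simp: component_def intro: linked_trans simp: linked_sym)
  then show False using x assms(3) component_eq_iff by metis
qed

lemma Ex1_iff_card: "(\<exists>!s. s \<in> B) \<longleftrightarrow> card B = 1"
  by (auto simp: card_1_singleton_iff)

lemma length_filter_linked:
  assumes "distinct ss" "set ss \<subseteq> V"
  shows "length (filter (linked A x) ss) = card (component V A x \<inter> set ss)"
proof -
  have "component V A x \<inter> set ss = set ss \<inter> {s. linked A x s}"
    using assms(2) by (auto simp: component_def)
  then show ?thesis by (simp add: distinct_length_filter[OF assms(1)] Int_commute)
qed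

text \<open>Edge subsets of an acyclic graph are acyclic, so only the condition on roots
  remains.\<close>

lemma rooted_forests_eq:
  assumes "acyclic_graph E" "distinct ss" "set ss \<subseteq> V"
  shows "rooted_forests V E (set ss) = {A \<in> Pow E. meets_once V A ss}"
proof -
  have "A \<in> rooted_forests V E (set ss) \<longleftrightarrow> A \<subseteq> E \<and> meets_once V A ss" for A
    using acyclic_graph_subset[OF assms(1), of A]
    unfolding rooted_forests_def spanning_forests_def graph_components_eq Ex1_iff_card meets_once_def
      length_filter_linked[OF assms(2,3)]
    by auto
  then show ?thesis by blast
qed

text \<open>Replaces the counting conditions in \<open>floating_rooted_forests\<close> by naming the
  floating component and describing all others.\<close>

definition floating :: "'a set \<Rightarrow> 'a set set \<Rightarrow> 'a set \<Rightarrow> 'a set \<Rightarrow> bool" where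
  "floating V A S C \<longleftrightarrow> C \<in> graph_components V A \<and> C \<inter> S = {} \<and>
     (\<forall>C'\<in>graph_components V A. C' \<noteq> C \<longrightarrow> card (C' \<inter> S) = 1)"

text \<open>A component \<open>C\<close> without roots is not among the \<open>card S\<close> rooted
  ones, so by counting these are exactly the components other than \<open>C\<close>. Conversely,
  those other components cut \<open>S\<close> into singletons, which gives their number.\<close>

lemma floating_rooted_forests_eq:
  assumes "acyclic_graph E" "finite V" "S \<subseteq> V"
  shows "floating_rooted_forests V E S = {A \<in> Pow E. \<exists>C. floating V A S C}"
proof -
  have "card (graph_components V A) = card S + 1 \<and>
      card {C \<in> graph_components V A. card (C \<inter> S) = 1} = card S \<and>
      (\<exists>C\<in>graph_components V A. C \<inter> S = {}) \<longleftrightarrow> (\<exists>C. floating V A S C)" for A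
  proof -
    let ?P = "graph_components V A"
    let ?R = "{C \<in> ?P. card (C \<inter> S) = 1}"
    have fin: "finite ?P" "finite S"
      using assms finite_subset by (auto simp: graph_components_eq)
    show ?thesis
    proof
      assume *: "card ?P = card S + 1 \<and> card ?R = card S \<and> (\<exists>C\<in>?P. C \<inter> S = {})"
      then obtain C where C: "C \<in> ?P" "C \<inter> S = {}" by blast
      have "?R = ?P - {C}"
        by (rule card_subset_eq) (use * C fin in auto)
      have "card (C' \<inter> S) = 1" if "C' \<in> ?P" "C' \<noteq> C" for C'
      proof -
        have "C' \<in> ?R" unfolding \<open>?R = ?P - {C}\<close> using that by simp
        then show ?thesis by simp
      qed
      then have "floating V A S C" using C by (simp add: floating_def)
      then show "\<exists>C. floating V A S C" ..
    next
      assume "\<exists>C. floating V A S C"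
      then obtain C where C: "C \<in> ?P" "C \<inter> S = {}"
        "\<And>C'. C' \<in> ?P \<Longrightarrow> C' \<noteq> C \<Longrightarrow> card (C' \<inter> S) = 1"
        unfolding floating_def by auto
      then have R: "?R = ?P - {C}" by auto
      have "S = (\<Union>C'\<in>?P - {C}. C' \<inter> S)"
      proof (intro equalityI subsetI)
        fix s assume "s \<in> S"
        then have "s \<in> component V A s" "component V A s \<in> ?P"
          using assms(3) component_self[of s V A] by (auto simp: graph_components_eq)
        then show "s \<in> (\<Union>C'\<in>?P - {C}. C' \<inter> S)" using \<open>s \<in> S\<close> C(2) by blast
      qed auto
      moreover have "card (\<Union>C'\<in>?P - {C}. C' \<inter> S) = (\<Sum>C'\<in>?P - {C}. card (C' \<inter> S))"
      proof (rule card_UN_disjoint)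
        show "\<forall>C1\<in>?P - {C}. \<forall>C2\<in>?P - {C}. C1 \<noteq> C2 \<longrightarrow> C1 \<inter> S \<inter> (C2 \<inter> S) = {}"
          using graph_components_disjoint[of _ V A] by blast
      qed (use fin in auto)
      ultimately have "card S = (\<Sum>C'\<in>?P - {C}. card (C' \<inter> S))" by simp
      also have "\<dots> = card (?P - {C})" using C(3) by simp
      finally show "card ?P = card S + 1 \<and> card ?R = card S \<and> (\<exists>C\<in>?P. C \<inter> S = {})"
        using R C(1,2) fin card_Suc_Diff1[OF fin(1) C(1)] by auto
    qed
  qed
  then show ?thesis
    using acyclic_graph_subset[OF assms(1)]
    unfolding floating_rooted_forests_def spanning_forests_def Ex1_iff_card by auto
qed

lemma floating_unique: "floating V A S C \<Longrightarrow> floating_component V S A = C"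
  unfolding floating_component_def
proof (rule the_equality)
  fix C'
  assume "floating V A S C" "C' \<in> graph_components V A \<and> C' \<inter> S = {}"
  then show "C' = C" unfolding floating_def by (metis card.empty zero_neq_one)
qed (simp add: floating_def)

text \<open>As an additional root, \<open>u\<close> raises the count of its own component by one and
  of no other, so that component must contain none of the remaining roots.\<close>

lemma meets_once_Cons_iff_floating:
  assumes "distinct ss" "set ss \<subseteq> V" "u \<in> V"
  shows "meets_once V A (u # ss) \<longleftrightarrow> floating V A (set ss) (component V A u)"
proof -
  have len: "length (filter (linked A x) (u # ss)) =
      of_bool (component V A x = component V A u) + card (component V A x \<inter> set ss)" if "x \<in> V" for x
    using component_eq_iff[OF assms(3) that] length_filter_linked[OF assms(1,2)] by simp
  have "meets_once V A (u # ss) \<longleftrightarrow> (\<forall>C\<in>graph_components V A.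
      of_bool (C = component V A u) + card (C \<inter> set ss) = 1)"
    unfolding meets_once_def graph_components_eq by (simp only: len ball_simps cong: ball_cong)
  also have "\<dots> \<longleftrightarrow> floating V A (set ss) (component V A u)"
    unfolding floating_def using assms(3) by (auto simp: graph_components_eq split: if_splits)
  finally show ?thesis .
qed

text \<open>The condition holds exactly when \<open>u\<close> and \<open>w\<close> both lie in the
  floating component \<open>C\<close>, so the double sum is the square of the weight of
  \<open>C\<close>, which is 2 minus its outdegree.\<close>

lemma sum_tau_floating:
  assumes tree: "grown_tree V E" and ss: "distinct ss" "set ss \<subseteq> V" and A: "A \<subseteq> E"
  shows "(\<Sum>u\<in>V. \<Sum>w\<in>V. tau E u * tau E w * of_bool (meets_once V A (u # ss) \<and> linked A u w)) =
    of_bool (\<exists>C. floating V A (set ss) C) * (real (floating_outdeg V E (set ss) A) - 2)\<^sup>2"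
proof (cases "\<exists>C. floating V A (set ss) C")
  case False
  then show ?thesis using meets_once_Cons_iff_floating[OF ss] by simp
next
  case True
  then obtain C where C: "floating V A (set ss) C" by blast
  then obtain r where r: "r \<in> V" "C = component V A r"
    unfolding floating_def graph_components_eq by blast
  have "finite V" using grown_tree_finite[OF tree] by simp
  have "C \<subseteq> V" using r by (auto simp: component_def)
  have iff: "meets_once V A (u # ss) \<and> linked A u w \<longleftrightarrow> u \<in> C \<and> w \<in> C" if "u \<in> V" "w \<in> V" for u w
  proof -
    have "meets_once V A (u # ss) \<longleftrightarrow> component V A u = C"
      using meets_once_Cons_iff_floating[OF ss that(1)] C floating_unique by metis
    also have "\<dots> \<longleftrightarrow> u \<in> C"
      using component_eq_iff[OF r(1) that(1)] that by (simp add: r(2) component_def linked_sym)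
    finally show ?thesis
      using that r by (auto simp: component_def intro: linked_trans simp: linked_sym)
  qed
  have "(\<Sum>u\<in>V. \<Sum>w\<in>V. tau E u * tau E w * of_bool (meets_once V A (u # ss) \<and> linked A u w)) =
      (\<Sum>u\<in>V. \<Sum>w\<in>V. (of_bool (u \<in> C) * tau E u) * (of_bool (w \<in> C) * tau E w))"
    by (intro sum.cong refl) (simp add: iff)
  also have "\<dots> = (\<Sum>u\<in>V. of_bool (u \<in> C) * tau E u)\<^sup>2"
    by (simp add: power2_eq_square sum_product)
  also have "(\<Sum>u\<in>V. of_bool (u \<in> C) * tau E u) = sum (tau E) C"
    by (rule sum.mono_neutral_cong_right) (use \<open>finite V\<close> \<open>C \<subseteq> V\<close> in auto)
  also have "sum (tau E) C = 2 - real (outdeg E C)"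
    using sum_tau_component[OF tree A r(1)] r(2) by simp
  also have "outdeg E C = floating_outdeg V E (set ss) A"
    by (simp add: outdeg_def floating_outdeg_def floating_unique[OF C])
  finally show ?thesis using True by (simp add: power2_commute)
qed

lemma sum_of_bool_times:
  fixes f :: "'b \<Rightarrow> real"
  assumes "finite X"
  shows "(\<Sum>x\<in>X. of_bool (P x) * f x) = sum f {x \<in> X. P x}"
  by (rule sum.mono_neutral_cong_right) (use assms in auto)

theorem theoremB:
  fixes V :: "'a set" and E :: "'a set set" and \<alpha> :: "'a set \<Rightarrow> real"
    and S :: "'a set" and ss :: "'a list"
  assumes "finite_tree V E"
    and "\<And>e. e \<in> E \<Longrightarrow> \<alpha> e > 0"
    and "S \<subseteq> V" and "S \<noteq> {}"
    and "distinct ss" and "set ss = S"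
  shows "det (principal_submatrix (tree_dist E \<alpha>) ss) =
    (-1) ^ (card S - 1) * 2 powi (int (card S) - 2) *
    ((\<Sum>e\<in>E. \<alpha> e) * (\<Sum>T\<in>rooted_forests V E S. coweight E \<alpha> T)
     - (\<Sum>F\<in>floating_rooted_forests V E S.
          coweight E \<alpha> F * (real (floating_outdeg V E S F) - 2)\<^sup>2))"
proof -
  have tree: "grown_tree V E" and acyc: "acyclic_graph E"
    using assms(1) finite_tree_grown by (auto simp: finite_tree_def)
  have ss: "set ss \<subseteq> V" using assms by simp
  have fin: "finite V" "finite E" using grown_tree_finite[OF tree] by auto
  \<comment> \<open>With \<open>k\<close> one less than the size of \<open>S\<close>, exponents need
    no natural-number subtraction.\<close>
  obtain k where k: "length ss = Suc k" using assms(4,6) by (cases ss) auto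
  have card_S: "card S = Suc k" using assms(5,6) k distinct_card by metis
  let ?L = "sum \<alpha> E" and ?D = "tree_dist E \<alpha>"
  define P where "P = (\<Sum>T\<in>rooted_forests V E S. coweight E \<alpha> T)"
  define R where "R = (\<Sum>F\<in>floating_rooted_forests V E S.
      coweight E \<alpha> F * (real (floating_outdeg V E S F) - 2)\<^sup>2)"
  have P: "coweight_sum E \<alpha> (\<lambda>A. meets_once V A ss) = P"
    using rooted_forests_eq[OF acyc assms(5) ss] assms(6) fin(2)
    by (simp only: P_def coweight_sum_def sum_of_bool_times finite_Pow_iff)
  let ?Z = "\<lambda>u w. coweight_sum E \<alpha> (\<lambda>A. meets_once V A (u # ss) \<and> linked A u w)"
  have "(\<Sum>u\<in>V. \<Sum>w\<in>V. tau E u * tau E w * ?Z u w) =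
      (\<Sum>u\<in>V. \<Sum>w\<in>V. \<Sum>A\<in>Pow E. coweight E \<alpha> A *
        (tau E u * tau E w * of_bool (meets_once V A (u # ss) \<and> linked A u w)))"
    unfolding coweight_sum_def sum_distrib_left by (intro sum.cong refl) simp
  \<comment> \<open>The sum over edge sets is moved outside, so that the vertex sums can be
    evaluated for each forest separately.\<close>
  also have "\<dots> = (\<Sum>A\<in>Pow E. coweight E \<alpha> A * (\<Sum>u\<in>V. \<Sum>w\<in>V.
      tau E u * tau E w * of_bool (meets_once V A (u # ss) \<and> linked A u w)))"
    unfolding sum_distrib_left by (subst (2) sum.swap) (subst sum.swap, rule refl)
  also have "\<dots> = (\<Sum>A\<in>Pow E. of_bool (\<exists>C. floating V A S C) *
      (coweight E \<alpha> A * (real (floating_outdeg V E S A) - 2)\<^sup>2))"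
    by (intro sum.cong refl) (simp add: sum_tau_floating[OF tree assms(5) ss] assms(6))
  also have "\<dots> = R"
    using floating_rooted_forests_eq[OF acyc fin(1) assms(3)] fin(2)
    by (simp only: R_def sum_of_bool_times finite_Pow_iff)
  finally have R: "(\<Sum>u\<in>V. \<Sum>w\<in>V. tau E u * tau E w * ?Z u w) = R" .
  have "(\<Sum>u\<in>V. \<Sum>w\<in>V. tau E u * tau E w * bordered_det ?L ?D (w # ss) (u # ss)) =
      (\<Sum>u\<in>V. \<Sum>w\<in>V. - ((-2) ^ Suc k) * (tau E u * tau E w * ?Z u w))"
    by (intro sum.cong refl) (simp add: bordered_det_forests[OF tree _ _ ss] k)
  also have "\<dots> = - ((-2) ^ Suc k) * R"
    unfolding R[symmetric] sum_distrib_left ..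
  \<comment> \<open>Equates the two evaluations of the weighted double sum of bordered determinants:
    by forests, and by the label \<open>Total\<close>.\<close>
  finally have "- ((-2) ^ Suc k) * R =
      2 * ?L * (-2) ^ k * P - 4 * det (principal_submatrix ?D ss)"
    using sum_tau_bordered_det[OF tree ss, of \<alpha>] bordered_det_rooted_forests[OF tree ss, of ?L \<alpha>] k P
    by simp
  then have "det (principal_submatrix ?D ss) = (-2) ^ k / 2 * (?L * P - R)"
    by (simp add: field_simps)
  \<comment> \<open>For a singleton \<open>S\<close> the power of 2 has exponent -1, hence the
    integer power.\<close>
  also have "(-2 :: real) ^ k / 2 = (-1) ^ k * 2 powi (int k - 1)"
    by (simp add: power_int_diff power_mult_distrib[symmetric])
  finally show ?thesis by (simp add: card_S P_def R_def)
qed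

end
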